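(* Let $(R,\mathfrak m)$ be a Noetherian local ring of dimension $d\ge1$, let $J$ be an $\mathfrak m$-primary ideal, and let $I=(J,h_1,\dots,h_m)$ with $h_1,\dots,h_m\in R$ integral over $J$, and let $s=\operatorname{red}_J(I)$. Then \[ e_1(I)-e_1(J)\le \lambda\big(R/(J:I)\big)\cdot\left[\binom{m+s}{s}-1\right]\cdot f_0(J). \]
   Context: $\lambda$ denotes length. For an $\mathfrak m$-primary ideal $K$, the Hilbert coefficients $e_i(K)$ are the integers with $\lambda(R/K^{n+1})=\sum_{i=0}^{d}(-1)^i e_i(K)\binom{n+d-i}{d-i}$ for $n\gg0$. $f_0(K)$ is the multiplicity of the special fiber ring $\bigoplus_{n\ge0}K^n/\mathfrak mK^n$, i.e. $\nu(K^n)=f_0(K)\binom{n+d-1}{d-1}+(\text{lower order terms})$ for $n\gg0$, where $\nu$ is minimal number of generators. Since $I$ is integral over $J$, $J$ is a reduction of $I$, and $\operatorname{red}_J(I)$ is the least $s\ge0$ with $I^{s+1}=JI^s$. $J:I=\{r\in R: rI\subseteq J\}$. *)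

theory Defs
  imports Main
begin

definition is_ideal :: "'a::comm_ring_1 set \<Rightarrow> bool" where
  "is_ideal I \<longleftrightarrow> 0 \<in> I \<and> (\<forall>x\<in>I. \<forall>y\<in>I. x + y \<in> I) \<and> (\<forall>r. \<forall>x\<in>I. r * x \<in> I)"

definition ideal_gen :: "'a::comm_ring_1 set \<Rightarrow> 'a set" where
  "ideal_gen S = \<Inter>{I. is_ideal I \<and> S \<subseteq> I}"

definition ideal_prod :: "'a::comm_ring_1 set \<Rightarrow> 'a set \<Rightarrow> 'a set" where
  "ideal_prod I J = ideal_gen {a * b | a b. a \<in> I \<and> b \<in> J}"

fun ideal_pow :: "'a::comm_ring_1 set \<Rightarrow> nat \<Rightarrow> 'a set" where
  "ideal_pow I 0 = UNIV"
| "ideal_pow I (Suc n) = ideal_prod I (ideal_pow I n)"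

definition ideal_colon :: "'a::comm_ring_1 set \<Rightarrow> 'a set \<Rightarrow> 'a set" where
  "ideal_colon J I = {r. \<forall>x\<in>I. r * x \<in> J}"

definition prime_ideal :: "'a::comm_ring_1 set \<Rightarrow> bool" where
  "prime_ideal P \<longleftrightarrow> is_ideal P \<and> P \<noteq> UNIV \<and> (\<forall>a b. a * b \<in> P \<longrightarrow> a \<in> P \<or> b \<in> P)"

definition maximal_ideal :: "'a::comm_ring_1 set \<Rightarrow> bool" where
  "maximal_ideal M \<longleftrightarrow> is_ideal M \<and> M \<noteq> UNIV \<and>
     (\<forall>I. is_ideal I \<and> M \<subseteq> I \<longrightarrow> I = M \<or> I = UNIV)"

definition local_ring :: "'a::comm_ring_1 set \<Rightarrow> bool" where
  "local_ring mm \<longleftrightarrow> maximal_ideal mm \<and> (\<forall>M. maximal_ideal M \<longrightarrow> M = mm)"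

definition noetherian_ring :: "'a::comm_ring_1 itself \<Rightarrow> bool" where
  "noetherian_ring _ \<longleftrightarrow> (\<forall>I::'a set. is_ideal I \<longrightarrow> (\<exists>S. finite S \<and> I = ideal_gen S))"

definition krull_dim :: "'a::comm_ring_1 itself \<Rightarrow> nat" where
  "krull_dim _ = (GREATEST n. \<exists>P :: nat \<Rightarrow> 'a set.
      (\<forall>i\<le>n. prime_ideal (P i)) \<and> (\<forall>i<n. P i \<subset> P (Suc i)))"

definition radical :: "'a::comm_ring_1 set \<Rightarrow> 'a set" where
  "radical I = {x. \<exists>k. x ^ k \<in> I}"

definition primary_to :: "'a::comm_ring_1 set \<Rightarrow> 'a set \<Rightarrow> bool" where
  "primary_to mm K \<longleftrightarrow> is_ideal K \<and> K \<noteq> UNIV \<and> radical K = mm"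

text \<open>Length of the R-module R/K: the R-submodules of R/K correspond to the ideals
  containing K, so the length is the supremum of lengths of strict chains of ideals
  from K to R.\<close>
definition quot_length :: "'a::comm_ring_1 set \<Rightarrow> nat" where
  "quot_length K = (GREATEST n. \<exists>C :: nat \<Rightarrow> 'a set.
      C 0 = K \<and> C n = UNIV \<and> (\<forall>i\<le>n. is_ideal (C i)) \<and> (\<forall>i<n. C i \<subset> C (Suc i)))"

definition num_gens :: "'a::comm_ring_1 set \<Rightarrow> nat" where
  "num_gens K = (LEAST n. \<exists>S. finite S \<and> card S = n \<and> ideal_gen S = K)"

definition hilbert_coeff :: "nat \<Rightarrow> 'a::comm_ring_1 set \<Rightarrow> nat \<Rightarrow> int" where
  "hilbert_coeff d K = (THE e :: nat \<Rightarrow> int. (\<forall>i>d. e i = 0) \<and>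
     (\<exists>N. \<forall>n\<ge>N. int (quot_length (ideal_pow K (n + 1))) =
        (\<Sum>i\<le>d. (-1) ^ i * e i * int ((n + d - i) choose (d - i)))))"

text \<open>Multiplicity f_0(K) of the special fiber ring, relative to dimension d \<ge> 1.\<close>
definition fiber_mult :: "nat \<Rightarrow> 'a::comm_ring_1 set \<Rightarrow> int" where
  "fiber_mult d K = (THE f :: int. \<exists>c :: nat \<Rightarrow> int. \<exists>N. \<forall>n\<ge>N.
      int (num_gens (ideal_pow K n)) =
        f * int ((n + d - 1) choose (d - 1)) + (\<Sum>i<d - 1. c i * int ((n + i) choose i)))"

definition integral_over_ideal :: "'a::comm_ring_1 set \<Rightarrow> 'a \<Rightarrow> bool" where
  "integral_over_ideal J h \<longleftrightarrow> (\<exists>k\<ge>1. \<exists>a :: nat \<Rightarrow> 'a. (\<forall>i\<in>{1..k}. a i \<in> ideal_pow J i) \<and>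
      h ^ k + (\<Sum>i=1..k. a i * h ^ (k - i)) = 0)"

definition red_num :: "'a::comm_ring_1 set \<Rightarrow> 'a set \<Rightarrow> nat" where
  "red_num J I = (LEAST s. ideal_pow I (s + 1) = ideal_prod J (ideal_pow I s))"

end

theory Submission
  imports Defs
begin

text \<open>
  Since \<open>I\<^sup>n\<^sup>+\<^sup>1 = J\<^sup>n\<^sup>+\<^sup>1\<^sup>-\<^sup>s I\<^sup>s\<close> for large \<open>n\<close>, the quotient \<open>I\<^sup>n\<^sup>+\<^sup>1/J\<^sup>n\<^sup>+\<^sup>1\<close> is filtered by the modules
  \<open>J\<^sup>n\<^sup>+\<^sup>1\<^sup>-\<^sup>j I\<^sup>j / J\<^sup>n\<^sup>+\<^sup>2\<^sup>-\<^sup>j I\<^sup>j\<^sup>-\<^sup>1\<close> with \<open>1 \<le> j \<le> s\<close>. Each is annihilated by \<open>J : I\<close> and is generated by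
  the products of generators of \<open>J\<^sup>n\<^sup>+\<^sup>1\<^sup>-\<^sup>j\<close> with the monomials of degree \<open>j\<close> in the \<open>h\<^sub>i\<close>; there are
  \<open>(m + s choose s) - 1\<close> monomials of degree \<open>1, \<dots>, s\<close> in total. The length of \<open>I\<^sup>n\<^sup>+\<^sup>1/J\<^sup>n\<^sup>+\<^sup>1\<close> is thus
  squeezed between \<open>0\<close> and a polynomial of degree \<open>d - 1\<close>, which forces \<open>e\<^sub>0(I) = e\<^sub>0(J)\<close>, and
  comparing the coefficients in degree \<open>d - 1\<close> gives the bound.

  That Hilbert polynomials have degree at most \<open>d\<close> comes from a system of parameters. That \<open>d\<close> is
  finite comes from Artin-Rees: a chain of \<open>r + 1\<close> primes makes the length of \<open>R/K\<^sup>n\<close> grow at least like \<open>n\<^sup>r\<close>.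

  Graded modules appear only as sequences of subquotients \<open>A\<^sub>n/B\<^sub>n\<close> of the ring itself.
\<close>

section \<open>The semiring of ideals\<close>

text \<open>The notions in the statement are given by \<open>GREATEST\<close>, \<open>LEAST\<close>
  and \<open>THE\<close>, so they carry information only after boundedness, existence or uniqueness
  is proved. In particular \<open>hilbert_coeff\<close> and \<open>fiber_mult\<close> presuppose
  polynomials of degree at most \<open>d\<close> and \<open>d - 1\<close>, whereas Hilbert-Serre
  bounds the degree only by a number of generators. The excess degree is removed afterwards by
  comparing growth (\<open>evp_dominated\<close>). The colon ideal annihilates the factors because
  \<open>(J : I) I\<close> lies in \<open>J\<close>: one factor \<open>I\<close> is traded for
  \<open>J\<close>. Passing from \<open>n\<close> to \<open>n - j\<close> does not change a leading
  coefficient, so every monomial of positive degree contributes one summand \<open>f_0(J)\<close>;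
  the \<open>-1\<close> removes the monomial of degree 0. \<open>e_1\<close> enters the Hilbert
  polynomial with a minus sign, so \<open>e_1(I) - e_1(J)\<close> is the coefficient in degree
  \<open>d - 1\<close> of the length of \<open>R/J^(n+1)\<close> minus that of
  \<open>R/I^(n+1)\<close>. It is a leading coefficient only once the terms in degree
  \<open>d\<close> have cancelled.\<close>

typedef (overloaded) 'a ideal = "{A :: 'a::comm_ring_1 set. is_ideal A}"
  morphisms iset Abs_ideal
  by (rule exI[of _ UNIV]) (simp add: is_ideal_def)

lemma is_ideal_iset [simp]: "is_ideal (iset A)"
  using iset[of A] by simp

lemma iset_Abs_ideal [simp]: "is_ideal A \<Longrightarrow> iset (Abs_ideal A) = A"
  by (simp add: Abs_ideal_inverse)

lemma iset_zero [simp, intro]: "0 \<in> iset A"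
  and iset_add [intro]: "x \<in> iset A \<Longrightarrow> y \<in> iset A \<Longrightarrow> x + y \<in> iset A"
  and iset_mult [intro]: "x \<in> iset A \<Longrightarrow> r * x \<in> iset A"
  using is_ideal_iset[of A] unfolding is_ideal_def by auto

lemma iset_mult2 [intro]: "x \<in> iset A \<Longrightarrow> x * r \<in> iset A"
  using iset_mult[of x A r] by (simp add: mult.commute)

lemma iset_uminus [intro]: "x \<in> iset A \<Longrightarrow> - x \<in> iset A"
  using iset_mult[of x A "-1"] by (simp only: mult_minus1)

lemma iset_diff [intro]: "x \<in> iset A \<Longrightarrow> y \<in> iset A \<Longrightarrow> x - y \<in> iset A"
  using iset_add[of x A "- y"] iset_uminus[of y A] by (simp only: add_uminus_conv_diff)

lemma is_ideal_ideal_gen: "is_ideal (ideal_gen S)"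
  unfolding ideal_gen_def is_ideal_def by blast

definition gen :: "'a::comm_ring_1 set \<Rightarrow> 'a ideal" where
  "gen S = Abs_ideal (ideal_gen S)"

lemma iset_gen: "iset (gen S) = ideal_gen S"
  by (simp add: gen_def is_ideal_ideal_gen)

instantiation ideal :: (comm_ring_1) "{order, semilattice_inf}"
begin

definition less_eq_ideal :: "'a ideal \<Rightarrow> 'a ideal \<Rightarrow> bool" where
  "less_eq_ideal A B \<longleftrightarrow> iset A \<subseteq> iset B"

definition less_ideal :: "'a ideal \<Rightarrow> 'a ideal \<Rightarrow> bool" where
  "less_ideal A B \<longleftrightarrow> iset A \<subset> iset B"

definition inf_ideal :: "'a ideal \<Rightarrow> 'a ideal \<Rightarrow> 'a ideal" where
  "inf_ideal A B = Abs_ideal (iset A \<inter> iset B)"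

lemma iset_inf [simp]: "iset (inf A B) = iset A \<inter> iset (B :: 'a ideal)"
proof -
  have "is_ideal (iset A \<inter> iset B)"
    unfolding is_ideal_def by auto
  then show ?thesis by (simp add: inf_ideal_def)
qed

instance
  by standard (auto simp: less_eq_ideal_def less_ideal_def iset_inject)

end

lemma ideal_leI: "(\<And>x. x \<in> iset A \<Longrightarrow> x \<in> iset B) \<Longrightarrow> A \<le> B"
  and ideal_leD: "A \<le> B \<Longrightarrow> x \<in> iset A \<Longrightarrow> x \<in> iset B"
  by (auto simp: less_eq_ideal_def)

lemma gen_le_iff: "gen S \<le> A \<longleftrightarrow> S \<subseteq> iset A"
proof -
  have "S \<subseteq> ideal_gen S" by (auto simp: ideal_gen_def)
  moreover have "ideal_gen S \<subseteq> iset A" if "S \<subseteq> iset A"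
    using that is_ideal_iset[of A] unfolding ideal_gen_def by blast
  ultimately show ?thesis unfolding less_eq_ideal_def iset_gen by blast
qed

lemma gen_mem: "x \<in> S \<Longrightarrow> x \<in> iset (gen S)"
  using gen_le_iff[of S "gen S"] by auto

lemma gen_iset [simp]: "gen (iset A) = A"
  by (rule antisym) (simp_all add: gen_le_iff, auto simp: less_eq_ideal_def intro: gen_mem)

definition icolon :: "'a::comm_ring_1 ideal \<Rightarrow> 'a ideal \<Rightarrow> 'a ideal" where
  "icolon C B = Abs_ideal (ideal_colon (iset C) (iset B))"

lemma iset_icolon [simp]: "iset (icolon C B) = ideal_colon (iset C) (iset B)"
proof -
  have "is_ideal (ideal_colon (iset C) (iset B))"
    unfolding is_ideal_def ideal_colon_def by (auto simp: distrib_right mult.assoc)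
  then show ?thesis by (simp add: icolon_def)
qed

text \<open>Ideals form an idempotent semiring in which \<open>1\<close> is the whole ring and the
  top element. With these classes, products and powers of ideals are computed by the ordinary
  semiring simplification and monotonicity rules.\<close>

instantiation ideal :: (comm_ring_1) "{comm_semiring_1, canonically_ordered_monoid_add, ordered_comm_semiring}"
begin

definition zero_ideal :: "'a ideal" where "zero_ideal = Abs_ideal {0}"
definition one_ideal :: "'a ideal" where "one_ideal = Abs_ideal UNIV"
definition plus_ideal :: "'a ideal \<Rightarrow> 'a ideal \<Rightarrow> 'a ideal" where
  "plus_ideal A B = Abs_ideal {a + b | a b. a \<in> iset A \<and> b \<in> iset B}"
definition times_ideal :: "'a ideal \<Rightarrow> 'a ideal \<Rightarrow> 'a ideal" where
  "times_ideal A B = gen {a * b | a b. a \<in> iset A \<and> b \<in> iset B}"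

lemma iset_0 [simp]: "iset (0 :: 'a ideal) = {0}"
  by (simp add: zero_ideal_def is_ideal_def)

lemma iset_1 [simp]: "iset (1 :: 'a ideal) = UNIV"
  by (simp add: one_ideal_def is_ideal_def)

lemma iset_plus: "iset (A + B :: 'a ideal) = {a + b | a b. a \<in> iset A \<and> b \<in> iset B}"
proof -
  have "is_ideal {a + b | a b. a \<in> iset A \<and> b \<in> iset B}"
    unfolding is_ideal_def
  proof (intro conjI ballI allI)
    show "0 \<in> {a + b | a b. a \<in> iset A \<and> b \<in> iset B}"
      using iset_zero[of A] iset_zero[of B] by force
  next
    fix x y assume "x \<in> {a + b | a b. a \<in> iset A \<and> b \<in> iset B}" "y \<in> {a + b | a b. a \<in> iset A \<and> b \<in> iset B}"
    then obtain a b a' b' where "x = a + b" "y = a' + b'" "a \<in> iset A" "b \<in> iset B" "a' \<in> iset A" "b' \<in> iset B"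
      by auto
    then have "x + y = (a + a') + (b + b')" "a + a' \<in> iset A" "b + b' \<in> iset B"
      by (auto simp: algebra_simps)
    then show "x + y \<in> {a + b | a b. a \<in> iset A \<and> b \<in> iset B}" by blast
  next
    fix r x assume "x \<in> {a + b | a b. a \<in> iset A \<and> b \<in> iset B}"
    then obtain a b where "x = a + b" "a \<in> iset A" "b \<in> iset B" by auto
    then have "r * x = r * a + r * b" "r * a \<in> iset A" "r * b \<in> iset B"
      by (auto simp: algebra_simps)
    then show "r * x \<in> {a + b | a b. a \<in> iset A \<and> b \<in> iset B}" by blast
  qed
  then show ?thesis by (simp add: plus_ideal_def)
qed

lemma ideal_plus_le_iff: "A + B \<le> C \<longleftrightarrow> A \<le> C \<and> B \<le> (C :: 'a ideal)"
proof
  assume h: "A + B \<le> C"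
  have "a \<in> iset (A + B)" if "a \<in> iset A" for a
    using that iset_zero[of B] unfolding iset_plus by force
  moreover have "b \<in> iset (A + B)" if "b \<in> iset B" for b
    using that iset_zero[of A] unfolding iset_plus by force
  ultimately show "A \<le> C \<and> B \<le> C" using h by (auto simp: less_eq_ideal_def)
qed (auto simp: less_eq_ideal_def iset_plus)

lemma times_le_iff: "A * B \<le> C \<longleftrightarrow> (\<forall>a\<in>iset A. \<forall>b\<in>iset B. a * b \<in> iset (C :: 'a ideal))"
  unfolding times_ideal_def gen_le_iff by auto

text \<open>Multiplication by \<open>B\<close> and the colon by \<open>B\<close> are adjoint. As the
  colon is again an ideal, an inclusion of a product need only be tested on generators of one
  factor.\<close>

lemma times_le_colon: "A * B \<le> C \<longleftrightarrow> A \<le> icolon C (B :: 'a ideal)"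
  unfolding times_le_iff by (auto simp: less_eq_ideal_def ideal_colon_def)

lemma plus_commute_aux: "A + B = B + (A :: 'a ideal)"
proof -
  have le: "C + D \<le> D + C" for C D :: "'a ideal"
    using ideal_plus_le_iff[of D C "D + C"] by (simp add: ideal_plus_le_iff)
  show ?thesis by (rule antisym) (rule le)+
qed

lemma plus_assoc_aux: "A + B + C = A + (B + (C :: 'a ideal))"
proof (rule antisym)
  show "A + B + C \<le> A + (B + C)"
    using ideal_plus_le_iff[of A "B + C" "A + (B + C)"] by (simp add: ideal_plus_le_iff)
  show "A + (B + C) \<le> A + B + C"
    using ideal_plus_le_iff[of "A + B" C "A + B + C"] by (simp add: ideal_plus_le_iff)
qed

lemma mult_commute_aux: "A * B = B * (A :: 'a ideal)"
proof -
  have "{a * b | a b. a \<in> iset A \<and> b \<in> iset B} = {a * b | a b. a \<in> iset B \<and> b \<in> iset A}"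
    using mult.commute by (metis (no_types, lifting))
  then show ?thesis by (simp add: times_ideal_def)
qed

lemma times_memI: "a \<in> iset A \<Longrightarrow> b \<in> iset B \<Longrightarrow> a * b \<in> iset (A * B :: 'a ideal)"
  using times_le_iff[of A B "A * B"] by auto

lemma times3_le_iff: "(A * B) * C \<le> D \<longleftrightarrow>
   (\<forall>a\<in>iset A. \<forall>b\<in>iset B. \<forall>c\<in>iset C. a * b * c \<in> iset (D :: 'a ideal))"
  unfolding times_le_colon[of "A * B"] by (simp add: times_le_iff ideal_colon_def)

lemma distrib_aux: "(A + B) * C = A * C + B * (C :: 'a ideal)"
proof (rule antisym)
  have "A * C \<le> A * C + B * C" "B * C \<le> A * C + B * C"
    using ideal_plus_le_iff[of "A * C" "B * C" "A * C + B * C"] by simp_all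
  then show "(A + B) * C \<le> A * C + B * C"
    by (simp add: times_le_colon ideal_plus_le_iff)
  have "A \<le> A + B" "B \<le> A + B"
    using ideal_plus_le_iff[of A B "A + B"] by simp_all
  then show "A * C + B * C \<le> (A + B) * C"
    by (auto simp: ideal_plus_le_iff times_le_iff intro!: times_memI dest: ideal_leD)
qed

instance
proof
  fix A B C D :: "'a ideal"
  show "A + B + C = A + (B + C)" by (rule plus_assoc_aux)
  show "A + B = B + A" by (rule plus_commute_aux)
  show "0 + A = A"
    by (rule antisym) (auto simp: less_eq_ideal_def iset_plus)
  show "A * B * C = A * (B * C)"
  proof (rule antisym)
    show "A * B * C \<le> A * (B * C)"
      unfolding times3_le_iff by (auto simp: mult.assoc intro!: times_memI)
    have "(B * C) * A \<le> A * B * C"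
      unfolding times3_le_iff
    proof (intro ballI)
      fix a b c assume "a \<in> iset B" "b \<in> iset C" "c \<in> iset A"
      then have "c * a * b \<in> iset (A * B * C)" by (intro times_memI)
      then show "a * b * c \<in> iset (A * B * C)" by (simp add: mult_ac)
    qed
    then show "A * (B * C) \<le> A * B * C" by (simp add: mult_commute_aux)
  qed
  show "A * B = B * A" by (rule mult_commute_aux)
  show "1 * A = A"
  proof (rule antisym)
    show "1 * A \<le> A" by (auto simp: times_le_iff)
    show "A \<le> 1 * A" using times_memI[of 1 1 _ A] by (auto simp: less_eq_ideal_def)
  qed
  show "(A + B) * C = A * C + B * C" by (rule distrib_aux)
  show "0 * A = 0"
    by (rule antisym) (simp_all add: times_le_iff, auto simp: less_eq_ideal_def)
  then show "A * 0 = 0" by (simp add: mult_commute_aux)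
  show "(0 :: 'a ideal) \<noteq> 1"
    by (metis UNIV_I iset_0 iset_1 singletonD zero_neq_one)
  show "A \<le> B \<longleftrightarrow> (\<exists>C. B = A + C)"
  proof
    assume "A \<le> B"
    then have "B = A + B"
      by (intro antisym) (metis order_refl ideal_plus_le_iff, simp add: ideal_plus_le_iff)
    then show "\<exists>C. B = A + C" ..
  next
    assume "\<exists>C. B = A + C"
    then show "A \<le> B" using ideal_plus_le_iff[of A _ B] by blast
  qed
  show "C * A \<le> C * B" if "A \<le> B"
    using that unfolding times_le_iff by (auto simp: less_eq_ideal_def intro!: times_memI)
  show "C + A \<le> C + B" if "A \<le> B"
    using that unfolding ideal_plus_le_iff
    by (metis order_refl order_trans ideal_plus_le_iff)
qed

end

declare ideal_plus_le_iff [simp]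

lemma ideal_add_idem [simp]: "A + A = (A :: 'a::comm_ring_1 ideal)"
  using ideal_plus_le_iff[of A A "A + A"] by (intro antisym) simp_all

lemma ideal_le_one [simp]: "(A :: 'a::comm_ring_1 ideal) \<le> 1"
  by (simp add: less_eq_ideal_def)

lemma ideal_le_plus1 [simp]: "A \<le> A + (B :: 'a::comm_ring_1 ideal)"
  and ideal_le_plus2 [simp]: "B \<le> A + (B :: 'a::comm_ring_1 ideal)"
  using ideal_plus_le_iff[of A B "A + B"] by auto

lemma ideal_le_plusI1: "X \<le> A \<Longrightarrow> X \<le> A + (B :: 'a::comm_ring_1 ideal)"
  and ideal_le_plusI2: "X \<le> B \<Longrightarrow> X \<le> A + (B :: 'a::comm_ring_1 ideal)"
  using order_trans[OF _ ideal_le_plus1] order_trans[OF _ ideal_le_plus2] by blast+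

lemma ideal_plus_absorb1: "A \<le> B \<Longrightarrow> A + B = (B :: 'a::comm_ring_1 ideal)"
  by (rule antisym) auto

lemma ideal_plus_absorb2: "B \<le> A \<Longrightarrow> A + B = (A :: 'a::comm_ring_1 ideal)"
  by (rule antisym) auto

lemma ideal_times_mono: "A \<le> B \<Longrightarrow> C \<le> D \<Longrightarrow> A * C \<le> B * (D :: 'a::comm_ring_1 ideal)"
  by (rule mult_mono) auto

lemma ideal_power_mono: "A \<le> B \<Longrightarrow> A ^ n \<le> (B :: 'a::comm_ring_1 ideal) ^ n"
  by (induction n) (auto intro: ideal_times_mono)

lemma ideal_times_le1: "A * B \<le> (A :: 'a::comm_ring_1 ideal)"
  and ideal_times_le2: "A * B \<le> (B :: 'a::comm_ring_1 ideal)"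
  using ideal_times_mono[of A A B 1] ideal_times_mono[of A 1 B B] by simp_all

lemma ideal_power_antimono: "m \<le> n \<Longrightarrow> (A :: 'a::comm_ring_1 ideal) ^ n \<le> A ^ m"
  by (metis le_add_diff_inverse power_add ideal_times_le1)

lemma ideal_one_le_iff: "1 \<le> A \<longleftrightarrow> A = (1 :: 'a::comm_ring_1 ideal)"
  by (auto intro: antisym)

lemma ideal_eq_one_iff: "A = 1 \<longleftrightarrow> 1 \<in> iset (A :: 'a::comm_ring_1 ideal)"
proof
  assume "1 \<in> iset A"
  then have "r \<in> iset A" for r using iset_mult[of 1 A r] by simp
  then show "A = 1" by (auto simp: iset_inject[symmetric])
qed simp

lemma ideal_plus_memI: "a \<in> iset A \<Longrightarrow> b \<in> iset B \<Longrightarrow> a + b \<in> iset (A + B)"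
  by (auto simp: iset_plus)

lemma ideal_plus_memE:
  assumes "x \<in> iset (A + B)"
  obtains a b where "x = a + b" "a \<in> iset A" "b \<in> iset B"
  using assms by (auto simp: iset_plus)

lemma ideal_plus_mem1: "a \<in> iset A \<Longrightarrow> a \<in> iset (A + B)"
  and ideal_plus_mem2: "b \<in> iset B \<Longrightarrow> b \<in> iset (A + B)"
  by (metis ideal_leD ideal_le_plus1, metis ideal_leD ideal_le_plus2)

lemma ideal_less_ex: "A < B \<Longrightarrow> \<exists>x. x \<in> iset B \<and> x \<notin> iset (A :: 'a::comm_ring_1 ideal)"
  by (auto simp: less_ideal_def)

lemma ideal_modular:
  assumes "A \<le> (C :: 'a::comm_ring_1 ideal)"
  shows "inf (A + B) C \<le> A + inf B C"
proof (rule ideal_leI)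
  fix x assume x: "x \<in> iset (inf (A + B) C)"
  then obtain a b where ab: "x = a + b" "a \<in> iset A" "b \<in> iset B"
    by (auto elim: ideal_plus_memE)
  moreover have "b = x - a" using ab by simp
  ultimately have "b \<in> iset C" using x assms ideal_leD by (metis IntE iset_diff iset_inf)
  then show "x \<in> iset (A + inf B C)" using ab by (auto intro: ideal_plus_memI)
qed

lemma gen_union: "gen (S \<union> T) = gen S + gen T"
  by (rule antisym) (auto simp: gen_le_iff intro: ideal_plus_mem1 ideal_plus_mem2 gen_mem)

lemma gen_empty [simp]: "gen {} = 0"
  using gen_le_iff[of "{}" 0] by simp

section \<open>Principal ideals\<close>

definition pideal :: "'a::comm_ring_1 \<Rightarrow> 'a ideal" where
  "pideal x = gen {x}"

lemma pideal_le_iff: "pideal x \<le> A \<longleftrightarrow> x \<in> iset A"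
  by (simp add: pideal_def gen_le_iff)

lemma pideal_mem: "x \<in> iset (pideal x)"
  using pideal_le_iff[of x "pideal x"] by simp

lemma gen_insert: "gen (insert x S) = pideal x + gen S"
  using gen_union[of "{x}" S] by (simp add: pideal_def)

text \<open>With a principal factor the products already form an ideal, so no sums of products
  occur. Later arguments can therefore pick a single cofactor.\<close>

lemma iset_pideal_times: "iset (pideal x * A) = {x * a | a. a \<in> iset A}"
proof
  have id: "is_ideal {x * a | a. a \<in> iset A}"
    unfolding is_ideal_def
  proof (intro conjI ballI allI)
    show "0 \<in> {x * a |a. a \<in> iset A}" using iset_zero[of A] by force
  next
    fix y z assume "y \<in> {x * a |a. a \<in> iset A}" "z \<in> {x * a |a. a \<in> iset A}"
    then obtain a b where "y = x * a" "z = x * b" "a \<in> iset A" "b \<in> iset A" by auto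
    then have "y + z = x * (a + b)" "a + b \<in> iset A" by (auto simp: algebra_simps)
    then show "y + z \<in> {x * a |a. a \<in> iset A}" by blast
  next
    fix r y assume "y \<in> {x * a |a. a \<in> iset A}"
    then obtain a where "y = x * a" "a \<in> iset A" by auto
    then have "r * y = x * (r * a)" "r * a \<in> iset A" by (auto simp: algebra_simps)
    then show "r * y \<in> {x * a |a. a \<in> iset A}" by blast
  qed
  let ?P = "Abs_ideal {x * a | a. a \<in> iset A}"
  have P: "iset ?P = {x * a | a. a \<in> iset A}" using id by simp
  have "pideal x * A \<le> ?P"
    by (auto simp: times_le_colon pideal_le_iff P ideal_colon_def)
  then show "iset (pideal x * A) \<subseteq> {x * a | a. a \<in> iset A}"
    unfolding less_eq_ideal_def P .
  show "{x * a | a. a \<in> iset A} \<subseteq> iset (pideal x * A)"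
    using times_memI[OF pideal_mem[of x]] by auto
qed

lemma iset_pideal: "iset (pideal x) = {x * a | a. True}"
  using iset_pideal_times[of x 1] by simp

lemma pideal_mult: "pideal (x * y) = pideal x * pideal y"
proof -
  have "iset (pideal (x * y)) = iset (pideal x * pideal y)"
    unfolding iset_pideal_times iset_pideal by (auto simp: mult.assoc)
  then show ?thesis by (simp add: iset_inject)
qed

lemma pideal_one [simp]: "pideal 1 = 1"
  by (auto simp: iset_inject[symmetric] iset_pideal)

lemma pideal_power: "pideal (x ^ n) = pideal x ^ n"
  by (induction n) (auto simp: pideal_mult)

lemma le_icolon_pideal_iff: "A \<le> icolon B (pideal y) \<longleftrightarrow> pideal y * A \<le> B"
  unfolding times_le_colon[symmetric] by (simp add: mult.commute)

lemma mem_icolon_pideal: "z \<in> iset (icolon B (pideal y)) \<longleftrightarrow> y * z \<in> iset B"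
  using le_icolon_pideal_iff[of "pideal z" B y]
  by (simp add: pideal_le_iff pideal_mult[symmetric])

lemma iset_times: "iset (A * B) = ideal_prod (iset A) (iset B)"
  by (simp add: times_ideal_def iset_gen ideal_prod_def)

lemma iset_power: "iset (A ^ n) = ideal_pow (iset A) n"
  by (induction n) (simp_all add: iset_times)

section \<open>Length of subquotients\<close>

text \<open>The ideals between \<open>B\<close> and \<open>A\<close> are the submodules of
  \<open>A/B\<close>, so subquotients can be measured without a type of modules.\<close>

definition ichain :: "'a::comm_ring_1 ideal \<Rightarrow> 'a ideal \<Rightarrow> nat \<Rightarrow> bool" where
  "ichain B A n \<longleftrightarrow> (\<exists>C. C 0 = B \<and> C n = A \<and> (\<forall>i<n. C i < C (Suc i)))"

text \<open>\<open>B \<le> A\<close> ensures that some chain exists and the bound that there is a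
  longest one; together they make the \<open>GREATEST\<close> in \<open>ilen\<close>
  meaningful.\<close>

definition flen :: "'a::comm_ring_1 ideal \<Rightarrow> 'a ideal \<Rightarrow> bool" where
  "flen B A \<longleftrightarrow> B \<le> A \<and> (\<exists>N. \<forall>n. ichain B A n \<longrightarrow> n \<le> N)"

definition ilen :: "'a::comm_ring_1 ideal \<Rightarrow> 'a ideal \<Rightarrow> nat" where
  "ilen B A = (GREATEST n. ichain B A n)"

lemma ichain_0 [simp]: "ichain B A 0 \<longleftrightarrow> A = B"
  by (auto simp: ichain_def)

lemma ichain_Suc: "ichain B A (Suc n) \<longleftrightarrow> (\<exists>C. ichain B C n \<and> C < A)"
proof
  assume "ichain B A (Suc n)"
  then obtain C where "C 0 = B" "C (Suc n) = A" "\<forall>i<Suc n. C i < C (Suc i)"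
    by (auto simp: ichain_def)
  then show "\<exists>C. ichain B C n \<and> C < A"
    by (intro exI[of _ "C n"]) (auto simp: ichain_def)
next
  assume "\<exists>C. ichain B C n \<and> C < A"
  then obtain C D where "C 0 = B" "C n = D" "\<forall>i<n. C i < C (Suc i)" "D < A"
    by (auto simp: ichain_def)
  then show "ichain B A (Suc n)"
    unfolding ichain_def
    by (intro exI[of _ "C(Suc n := A)"]) (auto simp: less_Suc_eq)
qed

lemma ichain_le: "ichain B A n \<Longrightarrow> B \<le> A"
  by (induction n arbitrary: A) (auto simp: ichain_Suc, metis order.strict_implies_order order.trans)

lemma ichain_append: "ichain B C m \<Longrightarrow> ichain C A n \<Longrightarrow> ichain B A (m + n)"
  by (induction n arbitrary: A) (auto simp: ichain_Suc)

lemma ichain_extend: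
  assumes "ichain B A n" "A \<le> A'"
  shows "\<exists>p. ichain B A' p \<and> n \<le> p \<and> (A \<noteq> A' \<longrightarrow> n < p)"
proof (cases "A = A'")
  case False
  then have "ichain B A' (Suc n)" using assms by (auto simp: ichain_Suc)
  then show ?thesis by (intro exI[of _ "Suc n"]) simp
qed (use assms in auto)

lemma ichain_exists: "B \<le> A \<Longrightarrow> \<exists>n. ichain B A n"
  using ichain_extend[of B B 0 A] by auto

lemma ichain_map:
  assumes "ichain B A n"
    and "\<And>X Y. B \<le> X \<Longrightarrow> X < Y \<Longrightarrow> Y \<le> A \<Longrightarrow> f X < f Y"
  shows "ichain (f B) (f A) n"
  using assms
proof (induction n arbitrary: A)
  case (Suc n)
  then obtain C where C: "ichain B C n" "C < A" by (auto simp: ichain_Suc)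
  then have "B \<le> C" using ichain_le by auto
  have "ichain (f B) (f C) n"
    using C by (intro Suc.IH) (auto intro: Suc.prems(2))
  moreover have "f C < f A" using C \<open>B \<le> C\<close> Suc.prems(2) by auto
  ultimately show ?case by (auto simp: ichain_Suc)
qed auto

text \<open>By the modular law, a proper step of a chain stays proper in \<open>C\<close> or modulo \<open>C\<close>.\<close>

lemma ichain_split:
  assumes "ichain B A n" "B \<le> C"
  shows "\<exists>p q. ichain B (inf A C) p \<and> ichain C (A + C) q \<and> n \<le> p + q"
  using assms
proof (induction n arbitrary: A)
  case 0
  then show ?case
    by (intro exI[of _ 0]) (auto simp: inf_absorb1 ideal_plus_absorb1)
next
  case (Suc n)
  then obtain A' where A': "ichain B A' n" "A' < A" by (auto simp: ichain_Suc)
  then obtain p q where pq: "ichain B (inf A' C) p" "ichain C (A' + C) q" "n \<le> p + q"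
    using Suc by blast
  have "inf A' C \<le> inf A C" "A' + C \<le> A + C"
    using A' by (auto intro: le_infI1 add_right_mono order_trans[of A' A])
  then obtain p' q' where p'q': "ichain B (inf A C) p'" "p \<le> p'" "inf A' C \<noteq> inf A C \<longrightarrow> p < p'"
      "ichain C (A + C) q'" "q \<le> q'" "A' + C \<noteq> A + C \<longrightarrow> q < q'"
    using ichain_extend[OF pq(1)] ichain_extend[OF pq(2)] by meson
  have "\<not> (inf A' C = inf A C \<and> A' + C = A + C)"
  proof
    assume eq: "inf A' C = inf A C \<and> A' + C = A + C"
    have "A = inf (A' + C) A" using eq by (intro antisym) auto
    also have "\<dots> \<le> A' + inf C A" using A' by (intro ideal_modular) auto
    also have "\<dots> \<le> A'" using eq by (simp add: inf_commute) (metis inf_le1)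
    finally show False using A' by auto
  qed
  then have "Suc n \<le> p' + q'" using p'q' pq(3) by auto
  then show ?case using p'q' by blast
qed

lemma flen_le: "flen B A \<Longrightarrow> B \<le> A"
  by (simp add: flen_def)

lemma ichain_ilen: "flen B A \<Longrightarrow> ichain B A (ilen B A)"
  unfolding flen_def ilen_def using ichain_exists by (metis GreatestI_ex_nat)

lemma ichain_le_ilen: "flen B A \<Longrightarrow> ichain B A n \<Longrightarrow> n \<le> ilen B A"
  unfolding flen_def ilen_def by (metis Greatest_le_nat)

lemma flenI: "B \<le> A \<Longrightarrow> (\<And>n. ichain B A n \<Longrightarrow> n \<le> N) \<Longrightarrow> flen B A"
  by (auto simp: flen_def)

lemma ilen_le: "flen B A \<Longrightarrow> (\<And>n. ichain B A n \<Longrightarrow> n \<le> N) \<Longrightarrow> ilen B A \<le> N"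
  using ichain_ilen by blast

lemma flen_refl [simp]: "flen A A"
proof (rule flenI)
  fix n assume "ichain A A n"
  then show "n \<le> 0" by (cases n) (auto simp: ichain_Suc dest: ichain_le)
qed simp

lemma ilen_refl [simp]: "ilen A A = 0"
  using ilen_le[of A A 0] ichain_le by (metis flen_refl ichain_Suc leD le_zero_eq not0_implies_Suc)

lemma flen_trans:
  assumes "flen B C" "flen C A"
  shows "flen B A"
proof (rule flenI)
  show "B \<le> A" using assms flen_le by (metis order_trans)
  fix n assume "ichain B A n"
  then obtain p q where "ichain B (inf A C) p" "ichain C (A + C) q" "n \<le> p + q"
    using ichain_split flen_le[OF assms(1)] by blast
  moreover have "inf A C = C" "A + C = A"
    using flen_le[OF assms(2)] by (auto simp: inf_absorb2 ideal_plus_absorb2)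
  ultimately show "n \<le> ilen B C + ilen C A"
    using assms ichain_le_ilen by (metis add_le_mono order_trans)
qed

lemma flen_sub:
  assumes "flen B A" "B \<le> B'" "B' \<le> A'" "A' \<le> A"
  shows "flen B' A'"
proof (rule flenI)
  fix n assume n: "ichain B' A' n"
  obtain p q where "ichain B B' p" "ichain A' A q" using assms ichain_exists by meson
  then have "ichain B A (p + n + q)" using n ichain_append by blast
  then show "n \<le> ilen B A" using ichain_le_ilen[OF assms(1)] by fastforce
qed (use assms in auto)

text \<open>Concatenating chains gives one inequality and \<open>ichain_split\<close> the other,
  since for \<open>C\<close> below \<open>A\<close> the intersection is \<open>C\<close> and the sum
  is \<open>A\<close>.\<close>

lemma ilen_add:
  assumes "flen B A" "B \<le> C" "C \<le> A"
  shows "ilen B A = ilen B C + ilen C A"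
proof (rule antisym)
  have fl: "flen B C" "flen C A" using assms flen_sub by blast+
  obtain p q where "ichain B (inf A C) p" "ichain C (A + C) q" "ilen B A \<le> p + q"
    using ichain_split assms ichain_ilen by blast
  moreover have "inf A C = C" "A + C = A"
    using assms by (auto simp: inf_absorb2 ideal_plus_absorb2)
  ultimately show "ilen B A \<le> ilen B C + ilen C A"
    using fl ichain_le_ilen by (metis add_le_mono order_trans)
  show "ilen B C + ilen C A \<le> ilen B A"
    using ichain_append ichain_ilen fl ichain_le_ilen assms(1) by blast
qed

lemma ilen_mono:
  assumes "flen B A" "B \<le> B'" "B' \<le> A'" "A' \<le> A"
  shows "ilen B' A' \<le> ilen B A"
proof -
  have le: "B' \<le> A" using assms(3,4) by (rule order_trans)
  have "ilen B A = ilen B B' + ilen B' A" using ilen_add[OF assms(1,2) le] .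
  moreover have "ilen B' A = ilen B' A' + ilen A' A"
    using ilen_add[OF flen_sub[OF assms(1,2) le] assms(3,4)] by simp
  ultimately show ?thesis by simp
qed

lemma ilen_pos: "flen B A \<Longrightarrow> B < A \<Longrightarrow> 0 < ilen B A"
  using ichain_le_ilen[of B A 1] by (simp add: ichain_Suc)

text \<open>Multiplication by \<open>y\<close> maps \<open>A\<close> onto \<open>(yA + B)/B\<close>
  with kernel \<open>A \<inter> (B : y)\<close>. Stating this isomorphism for chains transfers both
  finiteness and length.\<close>

lemma ichain_mult_iff:
  "ichain (inf A (icolon B (pideal y))) A n \<longleftrightarrow> ichain B (pideal y * A + B) n"
proof
  let ?D = "inf A (icolon B (pideal y))"
  assume n: "ichain ?D A n"
  have "ichain (pideal y * ?D + B) (pideal y * A + B) n"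
    using n
  proof (rule ichain_map)
    fix X Y assume XY: "?D \<le> X" "X < Y" "Y \<le> A"
    have le: "pideal y * X + B \<le> pideal y * Y + B"
      using XY by (intro add_mono ideal_times_mono) auto
    have "pideal y * X + B \<noteq> pideal y * Y + B"
    proof
      assume eq: "pideal y * X + B = pideal y * Y + B"
      have "Y \<le> X"
      proof (rule ideal_leI)
        fix z assume z: "z \<in> iset Y"
        then have "y * z \<in> iset (pideal y * X + B)"
          unfolding eq by (auto intro: ideal_plus_mem1 times_memI pideal_mem)
        then obtain x b where xb: "y * z = y * x + b" "x \<in> iset X" "b \<in> iset B"
          by (auto elim!: ideal_plus_memE simp: iset_pideal_times)
        have "z - x \<in> iset A" using z xb XY by (meson iset_diff ideal_leD less_imp_le)
        moreover have "y * (z - x) = b" using xb by (simp add: right_diff_distrib)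
        ultimately have "z - x \<in> iset ?D"
          using xb by (auto simp: mem_icolon_pideal simp del: iset_icolon)
        then have "z - x \<in> iset X" using XY ideal_leD by blast
        then have "x + (z - x) \<in> iset X" using xb by blast
        then show "z \<in> iset X" by simp
      qed
      then show False using XY by auto
    qed
    then show "pideal y * X + B < pideal y * Y + B" using le by (rule order.not_eq_order_implies_strict)
  qed
  moreover have "pideal y * ?D + B = B"
  proof (rule ideal_plus_absorb1)
    have "?D \<le> icolon B (pideal y)" by simp
    then show "pideal y * ?D \<le> B" by (simp only: le_icolon_pideal_iff)
  qed
  ultimately show "ichain B (pideal y * A + B) n" by simp
next
  \<comment> \<open>The inverse direction pulls ideals back along multiplication by
    \<open>y\<close>.\<close>
  let ?f = "\<lambda>E. inf A (icolon E (pideal y))"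
  assume n: "ichain B (pideal y * A + B) n"
  have "ichain (?f B) (?f (pideal y * A + B)) n"
    using n
  proof (rule ichain_map)
    fix X Y assume XY: "B \<le> X" "X < Y" "Y \<le> pideal y * A + B"
    have XYi: "iset X \<subseteq> iset Y" using XY by (auto simp: less_ideal_def)
    have le: "?f X \<le> ?f Y"
    proof (rule ideal_leI)
      fix z assume "z \<in> iset (?f X)"
      then show "z \<in> iset (?f Y)"
        using XYi by (auto simp: mem_icolon_pideal simp del: iset_icolon)
    qed
    obtain e where e: "e \<in> iset Y" "e \<notin> iset X" using XY ideal_less_ex by blast
    then have "e \<in> iset (pideal y * A + B)" using XY ideal_leD by blast
    then obtain a b where ab: "e = y * a + b" "a \<in> iset A" "b \<in> iset B"
      by (auto elim!: ideal_plus_memE simp: iset_pideal_times)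
    have b: "b \<in> iset X" "b \<in> iset Y" using ab XY ideal_leD XYi by blast+
    have "y * a = e - b" using ab by simp
    then have "y * a \<in> iset Y" using e b by auto
    moreover have "y * a \<notin> iset X" using e b ab by auto
    ultimately have "a \<in> iset (?f Y)" "a \<notin> iset (?f X)"
      using ab by (auto simp: mem_icolon_pideal simp del: iset_icolon)
    then have "?f X \<noteq> ?f Y" by metis
    then show "?f X < ?f Y" using le by (rule order.not_eq_order_implies_strict)
  qed
  moreover have "?f (pideal y * A + B) = A"
    by (rule inf_absorb1) (simp add: le_icolon_pideal_iff)
  ultimately show "ichain (?f B) A n" by simp
qed

lemma flen_mult_iff:
  "flen (inf A (icolon B (pideal y))) A \<longleftrightarrow> flen B (pideal y * A + B)"
  unfolding flen_def ichain_mult_iff by auto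

lemma ilen_mult_eq:
  "ilen B (pideal y * A + B) = ilen (inf A (icolon B (pideal y))) A"
proof -
  have "ichain (inf A (icolon B (pideal y))) A = ichain B (pideal y * A + B)"
    by (rule ext) (rule ichain_mult_iff)
  then show ?thesis by (simp add: ilen_def)
qed

text \<open>Each further generator adds a cyclic module annihilated by \<open>D\<close>, hence a
  quotient of \<open>R/D\<close>, whose length is at most that of \<open>R/D\<close>.\<close>

lemma flen_gens:
  assumes "finite S" "flen D 1" "D * gen S \<le> B"
  shows "flen B (B + gen S) \<and> ilen B (B + gen S) \<le> card S * ilen D 1"
  using assms
proof (induction S rule: finite_induct)
  case (insert s S)
  let ?C = "B + gen S"
  have D: "D * gen S \<le> B" "pideal s * D \<le> B"
    using insert.prems(2) by (simp_all add: gen_insert algebra_simps)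
  have "D \<le> inf 1 (icolon ?C (pideal s))"
    using D(2) by (auto simp: le_icolon_pideal_iff intro: order_trans)
  then have fl: "flen (inf 1 (icolon ?C (pideal s))) 1"
    and le: "ilen (inf 1 (icolon ?C (pideal s))) 1 \<le> ilen D 1"
    using flen_sub[OF insert.prems(1)] ilen_mono[OF insert.prems(1)] by auto
  have eq: "B + gen (insert s S) = pideal s * 1 + ?C"
    by (simp add: gen_insert algebra_simps)
  have fl2: "flen ?C (B + gen (insert s S))" and le2: "ilen ?C (B + gen (insert s S)) \<le> ilen D 1"
    using fl le unfolding eq flen_mult_iff ilen_mult_eq by auto
  have IH: "flen B ?C" "ilen B ?C \<le> card S * ilen D 1"
    using insert.IH[OF insert.prems(1) D(1)] by auto
  have "flen B (B + gen (insert s S))" using IH fl2 flen_trans by blast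
  moreover from this have "ilen B (B + gen (insert s S)) = ilen B ?C + ilen ?C (B + gen (insert s S))"
    using flen_le[OF IH(1)] flen_le[OF fl2] by (intro ilen_add)
  ultimately show ?case using IH le2 insert.hyps by simp
qed simp

lemma quot_length_iset: "quot_length (iset K) = ilen K 1"
proof -
  have "(\<exists>C. C 0 = iset K \<and> C n = UNIV \<and> (\<forall>i\<le>n. is_ideal (C i)) \<and> (\<forall>i<n. C i \<subset> C (Suc i)))
      \<longleftrightarrow> ichain K 1 n" for n
  proof
    assume "\<exists>C. C 0 = iset K \<and> C n = UNIV \<and> (\<forall>i\<le>n. is_ideal (C i)) \<and> (\<forall>i<n. C i \<subset> C (Suc i))"
    then obtain C where C: "C 0 = iset K" "C n = UNIV" "\<forall>i\<le>n. is_ideal (C i)" "\<forall>i<n. C i \<subset> C (Suc i)"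
      by blast
    then show "ichain K 1 n"
      unfolding ichain_def
      by (intro exI[of _ "\<lambda>i. Abs_ideal (C i)"])
        (auto simp: less_ideal_def one_ideal_def iset_inverse)
  next
    assume "ichain K 1 n"
    then obtain C where "C 0 = K" "C n = 1" "\<forall>i<n. C i < C (Suc i)"
      unfolding ichain_def by blast
    then show "\<exists>C. C 0 = iset K \<and> C n = UNIV \<and> (\<forall>i\<le>n. is_ideal (C i)) \<and> (\<forall>i<n. C i \<subset> C (Suc i))"
      by (intro exI[of _ "\<lambda>i. iset (C i)"]) (auto simp: less_ideal_def)
  qed
  then show ?thesis by (simp add: quot_length_def ilen_def)
qed

section \<open>Numerical polynomials\<close>

text \<open>\<open>k\<close> counts coefficients, so the degree is below \<open>k\<close> and
  \<open>c (k - 1)\<close> is the leading coefficient when \<open>k\<close> is positive. In this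
  binomial basis a backward difference merely lowers the index by one.\<close>

definition evp :: "nat \<Rightarrow> (nat \<Rightarrow> int) \<Rightarrow> (nat \<Rightarrow> int) \<Rightarrow> bool" where
  "evp k c f \<longleftrightarrow> (\<exists>N. \<forall>n\<ge>N. f n = (\<Sum>i<k. c i * int ((n + i) choose i)))"

lemma evp_add:
  assumes "evp k c f" "evp k e g"
  shows "evp k (\<lambda>i. c i + e i) (\<lambda>n. f n + g n)"
proof -
  obtain M N where "\<forall>n\<ge>M. f n = (\<Sum>i<k. c i * int ((n + i) choose i))"
      "\<forall>n\<ge>N. g n = (\<Sum>i<k. e i * int ((n + i) choose i))"
    using assms by (auto simp: evp_def)
  then show ?thesis unfolding evp_def
    by (intro exI[of _ "max M N"]) (simp add: sum.distrib distrib_right)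
qed

lemma evp_scale:
  assumes "evp k c f"
  shows "evp k (\<lambda>i. a * c i) (\<lambda>n. a * f n)"
proof -
  obtain M where "\<forall>n\<ge>M. f n = (\<Sum>i<k. c i * int ((n + i) choose i))"
    using assms by (auto simp: evp_def)
  then show ?thesis unfolding evp_def
    by (intro exI[of _ M]) (simp add: sum_distrib_left mult.assoc)
qed

lemma evp_diff:
  assumes "evp k c f" "evp k e g"
  shows "evp k (\<lambda>i. c i - e i) (\<lambda>n. f n - g n)"
  using evp_add[OF assms(1) evp_scale[OF assms(2), of "-1"]] by simp

lemma evp_const0: "evp k (\<lambda>_. 0) (\<lambda>_. 0)"
  by (simp add: evp_def)

lemma evp_sum:
  assumes "\<And>j. j \<in> A \<Longrightarrow> evp k (c j) (f j)"
  shows "evp k (\<lambda>i. \<Sum>j\<in>A. c j i) (\<lambda>n. \<Sum>j\<in>A. f j n)"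
  using assms by (induction A rule: infinite_finite_induct) (auto intro: evp_const0 evp_add)

lemma evp_pad:
  assumes "evp k c f" "k \<le> k'"
  shows "evp k' (\<lambda>i. if i < k then c i else 0) f"
proof -
  obtain M where M: "\<forall>n\<ge>M. f n = (\<Sum>i<k. c i * int ((n + i) choose i))"
    using assms by (auto simp: evp_def)
  have "(\<Sum>i<k'. (if i < k then c i else 0) * int ((n + i) choose i)) = (\<Sum>i<k. c i * int ((n + i) choose i))" for n
    using assms(2) by (intro sum.mono_neutral_cong_right) auto
  then show ?thesis using M by (auto simp: evp_def)
qed

lemma evp_drop:
  assumes "evp (Suc k) c f" "c k = 0"
  shows "evp k c f"
  using assms by (simp add: evp_def)

lemma evp_monomial: "evp (Suc k) (\<lambda>i. if i = k then a else 0) (\<lambda>n. a * int ((n + k) choose k))"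
proof -
  have "(\<Sum>i<k. (if i = k then a else 0) * int ((n + i) choose i)) = 0" for n
    by (intro sum.neutral) auto
  then show ?thesis by (simp add: evp_def)
qed

text \<open>Pascal's rule: the basis element of index \<open>i\<close> at \<open>n - 1\<close> is
  the one of index \<open>i\<close> at \<open>n\<close> minus the one of index \<open>i - 1\<close>.
  The top coefficient is unchanged, and the truncation at \<open>n = 0\<close> is harmless because
  only large \<open>n\<close> count.\<close>

lemma evp_shift_back:
  assumes "evp k c f"
  shows "evp k (\<lambda>i. c i - (if Suc i < k then c (Suc i) else 0)) (\<lambda>n. f (n - 1))"
proof -
  obtain M where M: "\<forall>n\<ge>M. f n = (\<Sum>i<k. c i * int ((n + i) choose i))"
    using assms by (auto simp: evp_def)
  have "(\<Sum>i<k. c i * int ((n + i) choose i)) =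
      (\<Sum>i<k. (c i - (if Suc i < k then c (Suc i) else 0)) * int ((Suc n + i) choose i))" for n
  proof (induction k)
    case (Suc k)
    have "(\<Sum>i<k. (c i - (if Suc i < Suc k then c (Suc i) else 0)) * int ((Suc n + i) choose i)) =
      (\<Sum>i<k. (c i - (if Suc i < k then c (Suc i) else 0)) * int ((Suc n + i) choose i)
        - (if Suc i = k then c k * int ((Suc n + i) choose i) else 0))"
      by (intro sum.cong) (auto simp: algebra_simps)
    also have "\<dots> = (\<Sum>i<k. c i * int ((n + i) choose i)) -
        (\<Sum>i<k. if Suc i = k then c k * int ((Suc n + i) choose i) else 0)"
      by (simp add: sum_subtractf Suc)
    also have "(\<Sum>i<k. if Suc i = k then c k * int ((Suc n + i) choose i) else 0) =
        c k * (int ((Suc n + k) choose k) - int ((n + k) choose k))"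
    proof (cases k)
      case (Suc j)
      have "(\<Sum>i<k. if Suc i = k then c k * int ((Suc n + i) choose i) else 0) =
          (\<Sum>i<k. if i = j then c k * int ((Suc n + j) choose j) else 0)"
        using Suc by (intro sum.cong) auto
      then show ?thesis using Suc by (simp add: sum.delta algebra_simps)
    qed simp
    finally show ?case by (simp add: algebra_simps)
  qed simp
  note eq = this
  have "f (n - 1) = (\<Sum>i<k. (c i - (if Suc i < k then c (Suc i) else 0)) * int ((n + i) choose i))"
    if "n \<ge> Suc M" for n
    using that eq[of "n - 1"] M by (cases n) auto
  then show ?thesis unfolding evp_def by blast
qed

text \<open>This is why all powers \<open>J^(n-j)\<close> with fixed \<open>j\<close> contribute the
  same leading coefficient \<open>f_0(J)\<close>.\<close>

lemma evp_shift_back_iter: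
  assumes "evp (Suc k) c f"
  shows "\<exists>c'. evp (Suc k) c' (\<lambda>n. f (n - j)) \<and> c' k = c k"
proof (induction j)
  case (Suc j)
  then obtain c' where c': "evp (Suc k) c' (\<lambda>n. f (n - j))" "c' k = c k" by blast
  show ?case using evp_shift_back[OF c'(1)] c'(2)
    by (intro exI[of _ "\<lambda>i. c' i - (if Suc i < Suc k then c' (Suc i) else 0)"]) simp
qed (use assms in auto)

text \<open>Summation raises every index by one; the constant of summation becomes the coefficient
  of index 0.\<close>

lemma evp_antidiff:
  assumes "evp k c g" "\<And>n. f (Suc n) = f n + g (Suc n)"
  shows "\<exists>c'. evp (Suc k) c' f"
proof -
  obtain M where M: "\<forall>n\<ge>M. g n = (\<Sum>i<k. c i * int ((n + i) choose i))"
    using assms by (auto simp: evp_def)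
  define h where "h n = f n - (\<Sum>i<k. c i * int ((n + Suc i) choose Suc i))" for n
  have step: "h (Suc n) = h n" if "n \<ge> M" for n
    using M that by (simp add: h_def assms(2) sum.distrib algebra_simps)
  have h: "h n = h M" if "n \<ge> M" for n
    using that by (induction n rule: dec_induct) (auto simp: step)
  have "f n = (\<Sum>i<Suc k. (case i of 0 \<Rightarrow> h M | Suc j \<Rightarrow> c j) * int ((n + i) choose i))" if "n \<ge> M" for n
    using h[OF that] by (simp only: sum.lessThan_Suc_shift) (simp add: h_def)
  then show ?thesis unfolding evp_def by blast
qed

lemma choose_mono_index: "i \<le> k \<Longrightarrow> (n + i) choose i \<le> (n + k) choose k"
  by (induction k rule: dec_induct) auto

text \<open>Stretching the argument by \<open>u\<close> costs only a constant factor, so it does not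
  change the order of growth.\<close>

lemma choose_scale: "u \<ge> 1 \<Longrightarrow> (u * n + k) choose k \<le> u ^ k * ((n + k) choose k)"
proof (induction k)
  case (Suc k)
  have "Suc k * ((u * n + Suc k) choose Suc k) = (u * n + Suc k) * ((u * n + k) choose k)"
    using Suc_times_binomial_eq[of "u * n + k" k] by (simp add: mult.commute)
  also have "\<dots> \<le> (u * (n + Suc k)) * (u ^ k * ((n + k) choose k))"
    using Suc mult_le_mono1[of 1 u "Suc k"] by (intro mult_mono) (auto simp: add_mult_distrib2)
  also have "\<dots> = u ^ Suc k * ((n + Suc k) * ((n + k) choose k))"
    by (simp only: power_Suc mult_ac)
  also have "(n + Suc k) * ((n + k) choose k) = Suc k * ((n + Suc k) choose Suc k)"
    using Suc_times_binomial_eq[of "n + k" k] by (simp add: mult.commute)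
  finally have "Suc k * ((u * n + Suc k) choose Suc k) \<le> Suc k * (u ^ Suc k * ((n + Suc k) choose Suc k))"
    by (simp only: mult.left_commute)
  then show ?case by (simp only: mult_le_cancel1)
qed simp

lemma evp_sum_abs_le:
  "\<bar>\<Sum>i<Suc k. c i * int ((n + i) choose i)\<bar> \<le> (\<Sum>i<Suc k. \<bar>c i\<bar>) * int ((n + k) choose k)"
proof -
  have "\<bar>\<Sum>i<Suc k. c i * int ((n + i) choose i)\<bar> \<le> (\<Sum>i<Suc k. \<bar>c i * int ((n + i) choose i)\<bar>)"
    by (rule sum_abs)
  also have "\<dots> \<le> (\<Sum>i<Suc k. \<bar>c i\<bar> * int ((n + k) choose k))"
    by (intro sum_mono) (auto simp: abs_mult intro!: mult_left_mono choose_mono_index)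
  finally show ?thesis by (simp only: sum_distrib_right[symmetric])
qed

lemma evp_bound:
  assumes "evp (Suc k) c f"
  shows "\<exists>C\<ge>0. \<exists>N. \<forall>n\<ge>N. f n \<le> C * int ((n + k) choose k)"
proof -
  obtain M where M: "\<forall>n\<ge>M. f n = (\<Sum>i<Suc k. c i * int ((n + i) choose i))"
    using assms by (auto simp: evp_def)
  have "f n \<le> (\<Sum>i<Suc k. \<bar>c i\<bar>) * int ((n + k) choose k)" if "n \<ge> M" for n
    using M[rule_format, OF that] abs_le_D1[OF evp_sum_abs_le[of c n k]] by (simp only:)
  moreover have "0 \<le> (\<Sum>i<Suc k. \<bar>c i\<bar>)" by (simp add: sum_nonneg)
  ultimately show ?thesis by blast
qed

text \<open>A negative integer leading coefficient is at most \<open>-1\<close>, and for large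
  \<open>n\<close> the top term then outweighs all the lower ones.\<close>

lemma evp_lead_nonneg:
  assumes "evp (Suc k) c f" "\<And>n. n \<ge> N \<Longrightarrow> 0 \<le> f n"
  shows "0 \<le> c k"
proof (rule ccontr)
  assume neg: "\<not> 0 \<le> c k"
  obtain M where M: "\<forall>n\<ge>M. f n = (\<Sum>i<Suc k. c i * int ((n + i) choose i))"
    using assms by (auto simp: evp_def)
  show False
  proof (cases k)
    case 0
    then show False using M assms(2)[of "max M N"] neg by simp
  next
    case (Suc j)
    define s where "s = (\<Sum>i<Suc j. \<bar>c i\<bar>)"
    \<comment> \<open>With \<open>b\<close> the binomial of index \<open>k - 1\<close>, the lower
      terms are at most \<open>s * b\<close>, while \<open>k\<close> times the top binomial equals
      \<open>(n + k) * b\<close>. An \<open>n\<close> above \<open>k * s\<close> therefore yields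
      the contradiction.\<close>
    define n where "n = max (max M N) (nat (int k * s + 1))"
    define b where "b = int ((n + j) choose j)"
    have b: "b > 0" by (simp add: b_def)
    have kb: "int k * int ((n + k) choose k) = int (n + k) * b"
      using Suc_times_binomial_eq[of "n + j" j] unfolding Suc b_def
      by (simp only: of_nat_mult[symmetric] add_Suc_right mult.commute)
    have n: "int n \<ge> int k * s + 1" by (simp add: n_def)
    have "0 \<le> f n" using assms(2) by (simp add: n_def)
    also have "f n = (\<Sum>i<Suc k. c i * int ((n + i) choose i))" using M by (simp add: n_def)
    also have "\<dots> \<le> s * b + c k * int ((n + k) choose k)"
      using evp_sum_abs_le[of c n j] unfolding Suc s_def b_def by simp
    also have "\<dots> \<le> s * b - int ((n + k) choose k)"
    proof -
      have "(c k + 1) * int ((n + k) choose k) \<le> 0"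
        using neg by (intro mult_nonpos_nonneg) auto
      then show ?thesis by (simp add: algebra_simps)
    qed
    finally have "int ((n + k) choose k) \<le> s * b" by simp
    then have "int k * int ((n + k) choose k) \<le> int k * (s * b)" by (intro mult_left_mono) auto
    then have "int (n + k) * b \<le> (int k * s) * b" by (simp add: kb mult.assoc)
    then have "int (n + k) \<le> int k * s" using b by simp
    then show False using n by simp
  qed
qed

lemma evp_lead_mono:
  assumes "evp (Suc k) c f" "evp (Suc k) e g" "\<And>n. n \<ge> N \<Longrightarrow> f n \<le> g n"
  shows "c k \<le> e k"
  using evp_lead_nonneg[OF evp_diff[OF assms(2,1)], of N] assms(3) by simp

lemma evp_unique:
  assumes "evp k c f" "evp k e f" "i < k"
  shows "c i = e i"
  using assms
proof (induction k)
  case (Suc k)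
  have ck: "c k = e k"
    using evp_lead_mono[OF Suc.prems(1,2), of 0] evp_lead_mono[OF Suc.prems(2,1), of 0] by simp
  have d: "evp k (\<lambda>i. c i - e i) (\<lambda>_. 0)"
    using evp_drop[OF evp_diff[OF Suc.prems(1,2)]] ck by simp
  have "c i - e i = 0" if "i < k" "evp k (\<lambda>i. c i - e i) (\<lambda>_. 0)" for i k
    using that
  proof (induction k)
    case (Suc k)
    have "c k - e k = 0"
      using evp_lead_mono[OF Suc.prems(2) evp_const0, of 0] evp_lead_mono[OF evp_const0 Suc.prems(2), of 0]
      by simp
    then show ?case using Suc evp_drop[OF Suc.prems(2)] by (cases "i = k") auto
  qed simp
  then show ?case using d ck Suc.prems(3) by (metis diff_eq_diff_eq diff_self less_SucE right_minus_eq)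
qed simp

lemma evp_dominated:
  assumes "evp k c f" "\<And>n. n \<ge> N \<Longrightarrow> 0 \<le> f n" "\<And>n. n \<ge> N \<Longrightarrow> f n \<le> C * int ((n + k') choose k')"
  shows "\<exists>c'. evp (Suc k') c' f"
  using assms(1)
proof (induction k)
  case (Suc k)
  show ?case
  proof (cases "k \<le> k'")
    case True
    then show ?thesis using evp_pad[OF Suc.prems] by auto
  next
    case False
    have "0 \<le> c k" using evp_lead_nonneg[OF Suc.prems] assms(2) by blast
    moreover have "evp (Suc k) (\<lambda>i. if i < Suc k' then if i = k' then C else 0 else 0)
        (\<lambda>n. C * int ((n + k') choose k'))"
      using evp_pad[OF evp_monomial] False by simp
    from evp_lead_mono[OF Suc.prems this, of N] have "c k \<le> 0" using assms(3) False by simp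
    ultimately show ?thesis using Suc.IH[OF evp_drop[OF Suc.prems]] by simp
  qed
qed (use evp_pad in blast)

section \<open>Chain conditions\<close>

lemma noetherian_fg:
  assumes "noetherian_ring TYPE('a::comm_ring_1)"
  shows "\<exists>S. finite S \<and> (A :: 'a ideal) = gen S"
  using assms is_ideal_iset[of A] unfolding noetherian_ring_def
  by (metis iset_gen iset_inject)

lemma noetherian_acc:
  fixes L :: "nat \<Rightarrow> 'a::comm_ring_1 ideal"
  assumes "noetherian_ring TYPE('a)" "\<And>n. L n \<le> L (Suc n)"
  shows "\<exists>N. \<forall>n\<ge>N. L n = L N"
proof -
  have mono: "L m \<le> L n" if "m \<le> n" for m n
    using lift_Suc_mono_le[of L, OF assms(2) that] .
  have "is_ideal (\<Union>n. iset (L n))"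
    unfolding is_ideal_def
  proof (intro conjI ballI allI)
    fix x z assume "x \<in> (\<Union>n. iset (L n))" "z \<in> (\<Union>n. iset (L n))"
    then obtain i j where "x \<in> iset (L i)" "z \<in> iset (L j)" by auto
    then have "x \<in> iset (L (max i j))" "z \<in> iset (L (max i j))"
      using mono ideal_leD by (meson max.cobounded1 max.cobounded2)+
    then show "x + z \<in> (\<Union>n. iset (L n))" by blast
  qed auto
  then obtain U where U: "iset U = (\<Union>n. iset (L n))" using iset_Abs_ideal by blast
  obtain S where S: "finite S" "U = gen S" using noetherian_fg[OF assms(1)] by blast
  have "\<forall>s\<in>S. \<exists>n. s \<in> iset (L n)" using U S gen_mem by blast
  then obtain f where f: "\<forall>s\<in>S. s \<in> iset (L (f s))" by metis
  define N where "N = (\<Sum>s\<in>S. f s)"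
  have "f s \<le> N" if "s \<in> S" for s using S(1) that by (auto simp: N_def intro: member_le_sum)
  then have "S \<subseteq> iset (L N)" using f mono ideal_leD by blast
  then have UN: "U \<le> L N" using S gen_le_iff by blast
  have "L n = L N" if "n \<ge> N" for n
  proof (rule antisym)
    have "L n \<le> U" using U by (auto simp: less_eq_ideal_def)
    then show "L n \<le> L N" using UN by (rule order_trans)
  qed (rule mono[OF that])
  then show ?thesis by blast
qed

lemma noetherian_induct [consumes 1, case_names step]:
  fixes A :: "'a::comm_ring_1 ideal"
  assumes "noetherian_ring TYPE('a)"
    and "\<And>A :: 'a ideal. (\<And>B. A < B \<Longrightarrow> P B) \<Longrightarrow> P A"
  shows "P A"
proof -
  have "wf {(B, A :: 'a ideal). A < B}"
    unfolding wf_iff_no_infinite_down_chain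
  proof
    assume "\<exists>f. \<forall>i. (f (Suc i), f i) \<in> {(B, A :: 'a ideal). A < B}"
    then obtain f :: "nat \<Rightarrow> 'a ideal" where f: "\<And>i. f i < f (Suc i)" by auto
    then obtain N where "\<forall>n\<ge>N. f n = f N"
      using noetherian_acc[OF assms(1), of f] less_imp_le by blast
    then have "f (Suc N) = f N" by (meson le_SucI order_refl)
    then show False using f[of N] by simp
  qed
  then show ?thesis
    by (induction A rule: wf_induct_rule) (use assms(2) in blast)
qed

text \<open>\<open>gnoeth Y B A\<close>: every graded submodule of \<open>\<Oplus>\<^sub>n A\<^sub>n/B\<^sub>n\<close>, on which the generators of \<open>Y\<close> act
  with degree one, is generated in bounded degree.\<close>

definition gnoeth ::
    "'a::comm_ring_1 ideal \<Rightarrow> (nat \<Rightarrow> 'a ideal) \<Rightarrow> (nat \<Rightarrow> 'a ideal) \<Rightarrow> bool" where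
  "gnoeth Y B A \<longleftrightarrow> (\<forall>E. (\<forall>n. B n \<le> E n \<and> E n \<le> A n \<and> Y * E n \<le> E (Suc n)) \<longrightarrow>
     (\<exists>N. \<forall>n\<ge>N. E (Suc n) = Y * E n + B (Suc n)))"

lemma gnoeth_subquotient:
  assumes "gnoeth Y B A" "\<And>n. B n \<le> B' n" "\<And>n. A' n \<le> A n"
  shows "gnoeth Y B' A'"
  unfolding gnoeth_def
proof (intro allI impI)
  fix E assume E: "\<forall>n. B' n \<le> E n \<and> E n \<le> A' n \<and> Y * E n \<le> E (Suc n)"
  then have "\<forall>n. B n \<le> E n \<and> E n \<le> A n \<and> Y * E n \<le> E (Suc n)"
    using assms(2,3) order_trans by blast
  then obtain N where N: "\<forall>n\<ge>N. E (Suc n) = Y * E n + B (Suc n)"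
    using assms(1) unfolding gnoeth_def by blast
  have "E (Suc n) = Y * E n + B' (Suc n)" if "n \<ge> N" for n
  proof (rule antisym)
    show "E (Suc n) \<le> Y * E n + B' (Suc n)"
      using N that assms(2) by (simp add: ideal_le_plusI2)
    show "Y * E n + B' (Suc n) \<le> E (Suc n)" using E by simp
  qed
  then show "\<exists>N. \<forall>n\<ge>N. E (Suc n) = Y * E n + B' (Suc n)" by blast
qed

text \<open>If \<open>y\<close> kills the graded module, \<open>y E n\<close> already lies in
  \<open>B (Suc n)\<close>, so \<open>y\<close> can be left out of the acting generators.\<close>

lemma gnoeth_annihilated:
  assumes "gnoeth (pideal y + Y) B A" "\<And>n. pideal y * A n \<le> B (Suc n)"
  shows "gnoeth Y B A"
  unfolding gnoeth_def
proof (intro allI impI)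
  fix E assume E: "\<forall>n. B n \<le> E n \<and> E n \<le> A n \<and> Y * E n \<le> E (Suc n)"
  have yE: "pideal y * E n \<le> B (Suc n)" for n
    using ideal_times_mono[of "pideal y" "pideal y" "E n" "A n"] E assms(2) order_trans by blast
  have "pideal y * E n \<le> E (Suc n)" for n
    using yE[of n] E order_trans by blast
  then have "(pideal y + Y) * E n \<le> E (Suc n)" for n
    using E by (simp add: distrib_right)
  then obtain N where N: "\<forall>n\<ge>N. E (Suc n) = (pideal y + Y) * E n + B (Suc n)"
    using assms(1) E unfolding gnoeth_def by blast
  have "E (Suc n) = Y * E n + B (Suc n)" if "n \<ge> N" for n
  proof -
    have "E (Suc n) = Y * E n + (pideal y * E n + B (Suc n))"
      using N that by (simp add: distrib_right add_ac)
    then show ?thesis using ideal_plus_absorb1[OF yE[of n]] by simp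
  qed
  then show "\<exists>N. \<forall>n\<ge>N. E (Suc n) = Y * E n + B (Suc n)" by blast
qed

text \<open>The kernel and the cokernel of multiplication by one generator are again of the form
  \<open>\<Oplus>\<^sub>n A\<^sub>n/B\<^sub>n\<close> for ideals of the same ring, and need one generator less.\<close>

theorem hilbert_serre:
  assumes "finite S"
    and "\<And>n. B n \<le> A n"
    and "\<And>n. gen S * A n \<le> A (Suc n)" "\<And>n. gen S * B n \<le> B (Suc n)"
    and "gnoeth (gen S) B A" "\<And>n. flen (B n) (A n)"
  shows "\<exists>c. evp (card S) c (\<lambda>n. int (ilen (B n) (A n)))"
  using assms
proof (induction S arbitrary: A B rule: finite_induct)
  case empty
  \<comment> \<open>Without generators the finiteness condition, applied to \<open>A\<close> itself,
    says that \<open>A n = B n\<close> for large \<open>n\<close>.\<close>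
  have "\<forall>n. B n \<le> A n \<and> A n \<le> A n \<and> gen {} * A n \<le> A (Suc n)"
    using empty.prems by simp
  then obtain N where "\<forall>n\<ge>N. A (Suc n) = gen {} * A n + B (Suc n)"
    using empty.prems(4) unfolding gnoeth_def by blast
  then have "ilen (B n) (A n) = 0" if "n \<ge> Suc N" for n
    using that by (cases n) auto
  then show ?case unfolding evp_def by (auto intro!: exI[of _ "Suc N"])
next
  case (insert y S)
  have yA: "pideal y * A n \<le> A (Suc n)" and SA: "gen S * A n \<le> A (Suc n)"
    and yB: "pideal y * B n \<le> B (Suc n)" and SB: "gen S * B n \<le> B (Suc n)" for n
    using insert.prems(2,3)[of n] by (simp_all add: gen_insert distrib_right)
  \<comment> \<open>\<open>A' n / B n\<close> is the kernel of \<open>y\<close> from degree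
    \<open>n\<close> to \<open>n + 1\<close>, and \<open>A n / B' n\<close> is the cokernel in
    degree \<open>n\<close>. Nothing arrives in degree 0, hence the case distinction for
    \<open>B'\<close>.\<close>
  define A' where "A' n = inf (A n) (icolon (B (Suc n)) (pideal y))" for n
  define B' where "B' n = (case n of 0 \<Rightarrow> B 0 | Suc m \<Rightarrow> pideal y * A m + B (Suc m))" for n
  have yA': "pideal y * A' n \<le> B (Suc n)" for n
    unfolding le_icolon_pideal_iff[symmetric] by (simp add: A'_def)
  have A'A: "A' n \<le> A n" for n by (simp add: A'_def)
  have BA': "B n \<le> A' n" for n
    using insert.prems(1) yB by (simp add: A'_def le_icolon_pideal_iff)
  have BB': "B n \<le> B' n" for n by (cases n) (simp_all add: B'_def)
  have B'A: "B' n \<le> A n" for n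
    using insert.prems(1) yA by (cases n) (simp_all add: B'_def)
  have yAB': "pideal y * A n \<le> B' (Suc n)" for n by (simp add: B'_def)
  have noeth: "gnoeth (pideal y + gen S) B A" using insert.prems(4) by (simp add: gen_insert)
  have "\<exists>c. evp (card S) c (\<lambda>n. int (ilen (B n) (A' n)))"
  proof (rule insert.IH)
    show "gen S * A' n \<le> A' (Suc n)" for n
    proof -
      have "gen S * A' n \<le> A (Suc n)"
        using ideal_times_mono[OF order_refl A'A] SA order_trans by blast
      moreover have "pideal y * (gen S * A' n) = gen S * (pideal y * A' n)"
        by (rule mult.left_commute)
      then have "pideal y * (gen S * A' n) \<le> B (Suc (Suc n))"
        using ideal_times_mono[OF order_refl yA'] SB order_trans by metis
      ultimately show ?thesis by (simp add: A'_def le_icolon_pideal_iff)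
    qed
    show "gnoeth (gen S) B A'"
      by (rule gnoeth_annihilated[OF gnoeth_subquotient[OF noeth]]) (auto simp: A'A yA')
    show "flen (B n) (A' n)" for n
      using flen_sub[OF insert.prems(5)] BA' A'A by blast
  qed (use BA' SB in auto)
  then obtain c1 where c1: "evp (card S) c1 (\<lambda>n. int (ilen (B n) (A' n)))" by blast
  have "\<exists>c. evp (card S) c (\<lambda>n. int (ilen (B' n) (A n)))"
  proof (rule insert.IH)
    show "gen S * B' n \<le> B' (Suc n)" for n
    proof (cases n)
      case 0
      then show ?thesis using SB[of 0] by (simp add: B'_def ideal_le_plusI2)
    next
      case (Suc m)
      have "gen S * (pideal y * A m) \<le> pideal y * A (Suc m)"
        using ideal_times_mono[OF order_refl SA, of "pideal y" m] by (simp only: mult.left_commute)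
      then show ?thesis using SB[of n] Suc ideal_le_plusI1 ideal_le_plusI2
        by (auto simp: B'_def distrib_left)
    qed
    show "gnoeth (gen S) B' A"
      by (rule gnoeth_annihilated[OF gnoeth_subquotient[OF noeth]]) (auto simp: BB' yAB')
    show "flen (B' n) (A n)" for n
      using flen_sub[OF insert.prems(5)] BB' B'A by blast
  qed (use B'A SA in auto)
  then obtain c2 where c2: "evp (card S) c2 (\<lambda>n. int (ilen (B' n) (A n)))" by blast
  let ?f = "\<lambda>n. int (ilen (B n) (A n))"
  \<comment> \<open>The kernel sits one degree before the cokernel. The recurrence uses
    \<open>?g\<close> only at successors, so the truncated \<open>n - 1\<close> does no
    harm.\<close>
  let ?g = "\<lambda>n. int (ilen (B' n) (A n)) - int (ilen (B (n - 1)) (A' (n - 1)))"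
  have "?f (Suc n) = ?f n + ?g (Suc n)" for n
  proof -
    have "ilen (B (Suc n)) (A (Suc n)) = ilen (B (Suc n)) (B' (Suc n)) + ilen (B' (Suc n)) (A (Suc n))"
      using insert.prems(5) BB' B'A by (rule ilen_add)
    moreover have "ilen (B (Suc n)) (B' (Suc n)) = ilen (A' n) (A n)"
      unfolding B'_def A'_def by (simp add: ilen_mult_eq)
    moreover have "ilen (B n) (A n) = ilen (B n) (A' n) + ilen (A' n) (A n)"
      using insert.prems(5) BA' A'A by (rule ilen_add)
    ultimately show ?thesis by simp
  qed
  then show ?case
    using evp_antidiff[OF evp_diff[OF c2 evp_shift_back[OF c1]], of ?f] insert.hyps by simp
qed

section \<open>The Rees algebra of an ideal is Noetherian\<close>

text \<open>Hilbert's basis theorem for homogeneous submodules: the coefficient ideals \<open>L j l\<close> of \<open>y\<^sup>j\<close>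
  form, for fixed \<open>j\<close>, a graded module over one generator less, and increase with \<open>j\<close>.\<close>

lemma rees_noetherian_step:
  fixes K :: "'a::comm_ring_1 ideal" and y :: 'a
  assumes noeth: "noetherian_ring TYPE('a)"
    and IH: "gnoeth K (\<lambda>_. 0) (\<lambda>n. K ^ n)"
  shows "gnoeth (pideal y + K) (\<lambda>_. 0) (\<lambda>n. (pideal y + K) ^ n)"
  unfolding gnoeth_def
proof (intro allI impI)
  fix A assume A: "\<forall>n. 0 \<le> A n \<and> A n \<le> (pideal y + K) ^ n \<and> (pideal y + K) * A n \<le> A (Suc n)"
  let ?P = "pideal y"
  have PA: "?P * A n \<le> A (Suc n)" and KA: "K * A n \<le> A (Suc n)" for n
    using A by (simp_all add: distrib_right)
  \<comment> \<open>The filtration of \<open>(y, K)^n\<close> by degree in \<open>y\<close>: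
    expressions of degree less than \<open>j\<close>.\<close>
  define F where "F j n = (\<Sum>i<j. ?P ^ i * K ^ (n - i))" for j n
  have F_Suc: "F (Suc j) n = F j n + ?P ^ j * K ^ (n - j)" for j n by (simp add: F_def)
  have PF: "?P * F j n \<le> F (Suc j) (Suc n)" for j n
  proof -
    have "F (Suc j) (Suc n) = K ^ Suc n + ?P * F j n"
      unfolding F_def by (simp only: sum.lessThan_Suc_shift) (simp add: sum_distrib_left mult_ac)
    then show ?thesis by simp
  qed
  \<comment> \<open>The condition on \<open>j\<close> keeps all exponents \<open>n - i\<close> free
    of truncation.\<close>
  have KF: "K * F j n = F j (Suc n)" if "j \<le> Suc n" for j n
    unfolding F_def sum_distrib_left using that
    by (intro sum.cong) (auto simp: Suc_diff_le mult_ac)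
  have F_mono: "F j n \<le> F (Suc j) n" for j n by (simp add: F_Suc)
  have Ftop: "(?P + K) ^ n \<le> F (Suc n) n" for n
  proof (induction n)
    case (Suc n)
    have "(?P + K) ^ Suc n = ?P * (?P + K) ^ n + K * (?P + K) ^ n" by (simp add: distrib_right)
    also have "\<dots> \<le> ?P * F (Suc n) n + K * F (Suc n) n"
      using Suc by (intro add_mono ideal_times_mono) auto
    also have "\<dots> \<le> F (Suc (Suc n)) (Suc n)"
      using PF[of "Suc n" n] KF[of "Suc n" n] F_mono[of "Suc n" "Suc n"] by simp
    finally show ?case .
  qed (simp add: F_def)
  \<comment> \<open>Inside the ring the coefficient of \<open>y^j\<close> is not unique.
    \<open>L j l\<close> therefore collects every \<open>w\<close> in \<open>K^l\<close> for which
    \<open>y^j w\<close> is congruent to an element of \<open>A (j + l)\<close> modulo lower degree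
    in \<open>y\<close>.\<close>
  define L where "L j l = inf (K ^ l) (icolon (A (j + l) + F j (j + l)) (pideal (y ^ j)))" for j l
  have L_le: "L j l \<le> K ^ l" for j l by (simp add: L_def)
  have PL: "?P ^ j * L j l \<le> A (j + l) + F j (j + l)" for j l
    unfolding pideal_power[symmetric] le_icolon_pideal_iff[symmetric] by (simp add: L_def)
  have LI: "X \<le> L j l" if "X \<le> K ^ l" "?P ^ j * X \<le> A (j + l) + F j (j + l)" for X j l
    using that by (simp add: L_def le_icolon_pideal_iff pideal_power[symmetric])
  have L_Suc1: "L j l \<le> L (Suc j) l" for j l
  proof (rule LI[OF L_le])
    have "?P ^ Suc j * L j l = ?P * (?P ^ j * L j l)" by (simp add: mult_ac)
    also have "\<dots> \<le> ?P * (A (j + l) + F j (j + l))" by (intro ideal_times_mono PL) simp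
    also have "\<dots> \<le> A (Suc j + l) + F (Suc j) (Suc j + l)"
      using PA PF by (simp add: distrib_left ideal_le_plusI1 ideal_le_plusI2)
    finally show "?P ^ Suc j * L j l \<le> A (Suc j + l) + F (Suc j) (Suc j + l)" .
  qed
  have L_Suc2: "K * L j l \<le> L j (Suc l)" for j l
  proof (rule LI)
    show "K * L j l \<le> K ^ Suc l" using ideal_times_mono[OF order_refl L_le] by simp
    have "?P ^ j * (K * L j l) = K * (?P ^ j * L j l)" by (rule mult.left_commute)
    also have "\<dots> \<le> K * (A (j + l) + F j (j + l))" by (intro ideal_times_mono PL) simp
    also have "\<dots> \<le> A (j + Suc l) + F j (j + Suc l)"
      using KA KF[of j "j + l"]
      by (simp add: distrib_left ideal_le_plusI1)
    finally show "?P ^ j * (K * L j l) \<le> A (j + Suc l) + F j (j + Suc l)" .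
  qed
  have L_mono: "L j l \<le> L j' l" if "j \<le> j'" for j j' l
    by (rule lift_Suc_mono_le[of "\<lambda>j. L j l", OF L_Suc1 that])
  have "\<forall>l. \<exists>j0. \<forall>j\<ge>j0. L j l = L j0 l"
  proof
    fix l
    show "\<exists>j0. \<forall>j\<ge>j0. L j l = L j0 l"
      using noetherian_acc[OF noeth, of "\<lambda>j. L j l"] L_Suc1 by blast
  qed
  then obtain J where J: "\<And>l j. j \<ge> J l \<Longrightarrow> L j l = L (J l) l" by metis
  define M where "M l = L (J l) l" for l
  have LM: "L j l \<le> M l" for j l
    using L_mono[of j "max j (J l)" l] J[of l "max j (J l)"] by (simp add: M_def)
  have "K * M l \<le> M (Suc l)" for l
    unfolding M_def[of l] using L_Suc2 LM order_trans by blast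
  then have "\<exists>N. \<forall>l\<ge>N. M (Suc l) = K * M l + 0"
    using IH L_le unfolding gnoeth_def by (elim allE[of _ M]) (simp add: M_def)
  then obtain l0 where l0: "\<And>l. l \<ge> l0 \<Longrightarrow> M (Suc l) = K * M l" by auto
  \<comment> \<open>One index serves all \<open>l\<close>: up to \<open>l0\<close> finitely many
    stabilisation points are summed, and beyond \<open>l0\<close> the equation
    \<open>M (Suc l) = K * M l\<close> propagates the stability.\<close>
  define j0 where "j0 = (\<Sum>l\<le>l0. J l)"
  have Lj0: "L j l = M l" if "j \<ge> j0" for j l
  proof (cases "l \<le> l0")
    case True
    then have "J l \<le> j0" unfolding j0_def by (intro member_le_sum) auto
    then show ?thesis using J[of l j] that by (simp add: M_def)
  next
    case False
    then have "l0 \<le> l" by simp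
    then show ?thesis
    proof (induction l rule: dec_induct)
      case base
      have "J l0 \<le> j0" unfolding j0_def by (intro member_le_sum) auto
      then show ?case using J[of l0 j] that by (simp add: M_def)
    next
      case (step l)
      have "M (Suc l) \<le> L j (Suc l)" using l0[OF step(1)] step L_Suc2[of j l] by simp
      then show ?case using LM by (intro antisym)
    qed
  qed
  have "\<forall>j. \<exists>N. \<forall>l\<ge>N. L j (Suc l) = K * L j l"
  proof
    fix j
    show "\<exists>N. \<forall>l\<ge>N. L j (Suc l) = K * L j l"
      using IH L_le L_Suc2 unfolding gnoeth_def by (elim allE[of _ "L j"]) simp
  qed
  then obtain l1 where l1: "\<And>j l. l \<ge> l1 j \<Longrightarrow> L j (Suc l) = K * L j l" by metis
  \<comment> \<open>For \<open>j + l = n + 1\<close> with \<open>n \<ge> N\<close>, either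
    \<open>j > j0\<close> or \<open>l > l1 j\<close>, so a top term in degree \<open>n + 1\<close>
    comes from degree \<open>n\<close> through a factor \<open>y\<close> or a factor
    \<open>K\<close>.\<close>
  define N where "N = j0 + (\<Sum>j\<le>j0. l1 j)"
  have lead: "?P ^ j * L j l \<le> (?P + K) * A n + F j (Suc n)"
    if n: "n \<ge> N" "j + l = Suc n" for j l n
  proof (cases "j > j0")
    case True
    then obtain i where i: "j = Suc i" "i \<ge> j0" by (cases j) auto
    have il: "i + l = n" using i n by simp
    have "?P ^ j * L j l = ?P * (?P ^ i * L i l)" using Lj0 i by (simp add: mult_ac)
    also have "\<dots> \<le> ?P * (A n + F i n)" using PL[of i l] il by (intro ideal_times_mono) auto
    also have "\<dots> \<le> (?P + K) * A n + F j (Suc n)"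
      using PF[of i n] i(1)
      by (auto simp: distrib_left distrib_right add.assoc intro: ideal_le_plusI2)
    finally show ?thesis .
  next
    case False
    then have "l1 j \<le> (\<Sum>j\<le>j0. l1 j)" by (intro member_le_sum) auto
    then have "l \<ge> Suc (l1 j)" using n False by (simp add: N_def)
    then obtain k where k: "l = Suc k" "k \<ge> l1 j" by (cases l) auto
    have jk: "j + k = n" using k n by simp
    have "?P ^ j * L j l = K * (?P ^ j * L j k)"
      using l1[OF k(2)] k(1) by (simp add: mult.left_commute)
    also have "\<dots> \<le> K * (A n + F j n)" using PL[of j k] jk by (intro ideal_times_mono) auto
    also have "\<dots> \<le> (?P + K) * A n + F j (Suc n)"
      using KF[of j n] jk
      by (auto simp: distrib_left distrib_right intro: ideal_le_plusI1)
    finally show ?thesis .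
  qed
  \<comment> \<open>Induction on the degree in \<open>y\<close>: \<open>lead\<close> takes care of
    the top term, and the modular law puts the remainder of lower degree back into
    \<open>A (Suc n)\<close>.\<close>
  have claim: "inf (A (Suc n)) (F j (Suc n)) \<le> (?P + K) * A n" if n: "n \<ge> N" and "j \<le> Suc (Suc n)" for j n
    using that(2)
  proof (induction j)
    case (Suc j)
    let ?l = "Suc n - j"
    have jl: "j + ?l = Suc n" using Suc.prems by simp
    have K_le: "(?P + K) * A n \<le> A (Suc n)" using A by blast
    have "inf (A (Suc n)) (F (Suc j) (Suc n)) \<le> (?P + K) * A n + F j (Suc n)"
    proof (rule ideal_leI)
      fix z assume z: "z \<in> iset (inf (A (Suc n)) (F (Suc j) (Suc n)))"
      then obtain f w where fw: "z = f + y ^ j * w" "f \<in> iset (F j (Suc n))" "w \<in> iset (K ^ ?l)"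
        by (auto simp: F_Suc pideal_power[symmetric] iset_pideal_times elim!: ideal_plus_memE)
      have zf: "y ^ j * w = z + (- f)" using fw by simp
      have "y ^ j * w \<in> iset (A (Suc n) + F j (Suc n))"
        unfolding zf using z iset_uminus[OF fw(2)] by (intro ideal_plus_memI) auto
      then have "w \<in> iset (L j ?l)"
        using fw(3) jl by (simp add: L_def mem_icolon_pideal del: iset_icolon)
      then have "y ^ j * w \<in> iset (?P ^ j * L j ?l)"
        by (auto simp: pideal_power[symmetric] intro: times_memI pideal_mem)
      then have "y ^ j * w \<in> iset ((?P + K) * A n + F j (Suc n))"
        using lead[OF n jl] ideal_leD by blast
      then show "z \<in> iset ((?P + K) * A n + F j (Suc n))"
        using fw by (auto intro: iset_add ideal_plus_mem2)
    qed
    then have "inf (A (Suc n)) (F (Suc j) (Suc n)) \<le> inf ((?P + K) * A n + F j (Suc n)) (A (Suc n))"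
      by simp
    also have "\<dots> \<le> (?P + K) * A n + inf (F j (Suc n)) (A (Suc n))"
      using K_le by (rule ideal_modular)
    also have "\<dots> \<le> (?P + K) * A n"
      using Suc by (simp add: inf_commute)
    finally show ?case .
  qed (simp add: F_def less_eq_ideal_def)
  have "A (Suc n) = (?P + K) * A n" if "n \<ge> N" for n
  proof (rule antisym)
    have "A (Suc n) \<le> F (Suc (Suc n)) (Suc n)" using A Ftop order_trans by blast
    then show "A (Suc n) \<le> (?P + K) * A n"
      using claim[OF that, of "Suc (Suc n)"] by (simp add: inf_absorb1)
  qed (use A in blast)
  then show "\<exists>N. \<forall>n\<ge>N. A (Suc n) = (?P + K) * A n + 0" by auto
qed

theorem rees_noetherian:
  fixes K :: "'a::comm_ring_1 ideal"
  assumes "noetherian_ring TYPE('a)"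
  shows "gnoeth K (\<lambda>_. 0) (\<lambda>n. K ^ n)"
proof -
  have "gnoeth (gen S) (\<lambda>_. 0) (\<lambda>n. gen S ^ n)" if "finite S" for S :: "'a set"
    using that
  proof (induction S rule: finite_induct)
    case empty
    have "E (Suc n) = 0" if "\<forall>n. E n \<le> (0 :: 'a ideal) ^ n" for E n
      using that[rule_format, of "Suc n"] by simp
    then show ?case unfolding gnoeth_def by auto
  next
    case (insert y S)
    then show ?case using rees_noetherian_step[OF assms] by (simp add: gen_insert)
  qed
  then show ?thesis using noetherian_fg[OF assms] by metis
qed

text \<open>The intersections of \<open>K^n\<close> with \<open>C\<close> form a graded submodule of
  the Rees algebra, so from some degree \<open>c\<close> on each is \<open>K\<close> times its
  predecessor.\<close>

lemma artin_rees:
  fixes K C :: "'a::comm_ring_1 ideal"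
  assumes "noetherian_ring TYPE('a)"
  shows "\<exists>c. \<forall>n. inf (K ^ (n + c)) C \<le> K ^ n * C"
proof -
  define A where "A n = inf (K ^ n) C" for n
  have "K * A n \<le> A (Suc n)" for n
  proof -
    have "K * A n \<le> K * K ^ n" "K * A n \<le> K * C"
      unfolding A_def by (intro ideal_times_mono; simp)+
    then show ?thesis
      unfolding A_def using ideal_times_le2[of K C] order_trans by auto
  qed
  then have "\<exists>N. \<forall>n\<ge>N. A (Suc n) = K * A n + 0"
    using rees_noetherian[OF assms, of K] unfolding gnoeth_def
    by (elim allE[of _ A]) (simp add: A_def)
  then obtain c where c: "\<And>n. n \<ge> c \<Longrightarrow> A (Suc n) = K * A n" by auto
  have "A (n + c) = K ^ n * A c" for n
    by (induction n) (simp_all add: c mult.assoc)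
  then have "A (n + c) \<le> K ^ n * C" for n
    using ideal_times_mono[OF order_refl, of "A c" C "K ^ n"] by (simp add: A_def)
  then show ?thesis unfolding A_def by blast
qed

section \<open>Noetherian local rings\<close>

abbreviation is_prime :: "'a::comm_ring_1 ideal \<Rightarrow> bool" where
  "is_prime P \<equiv> prime_ideal (iset P)"

lemma is_prime_mem: "is_prime P \<Longrightarrow> a * b \<in> iset P \<Longrightarrow> a \<in> iset P \<or> b \<in> iset P"
  by (auto simp: prime_ideal_def)

lemma is_prime_not_one: "is_prime P \<Longrightarrow> P \<noteq> 1"
  by (auto simp: prime_ideal_def)

lemma is_primeI:
  assumes "P \<noteq> 1" "\<And>a b. a \<notin> iset P \<Longrightarrow> b \<notin> iset P \<Longrightarrow> a * b \<notin> iset P"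
  shows "is_prime P"
  using assms unfolding prime_ideal_def by (auto simp: iset_inject[symmetric])

lemma is_prime_mult_le:
  assumes "is_prime P" "A * B \<le> P"
  shows "A \<le> P \<or> B \<le> P"
proof (rule ccontr)
  assume "\<not> (A \<le> P \<or> B \<le> P)"
  then obtain a b where "a \<in> iset A" "a \<notin> iset P" "b \<in> iset B" "b \<notin> iset P"
    by (auto simp: less_eq_ideal_def)
  then show False using assms is_prime_mem times_le_iff by blast
qed

lemma less_plus_pideal: "x \<notin> iset A \<Longrightarrow> A < A + pideal x"
  using ideal_plus_mem2[OF pideal_mem, of x A] by (auto simp: order.strict_iff_order)

text \<open>Locality is recorded as \<open>M\<close> being the greatest proper ideal, the form in
  which units and primes are handled below.\<close>

locale noetherian_local =
  fixes M :: "'a::comm_ring_1 ideal"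
  assumes noeth: "noetherian_ring TYPE('a)"
    and M_proper: "M \<noteq> 1"
    and M_greatest: "A \<noteq> 1 \<Longrightarrow> A \<le> M"

text \<open>Noetherian induction puts every proper ideal inside a maximal one, and uniqueness
  identifies that one with \<open>mm\<close>.\<close>

lemma noetherian_localI:
  assumes "noetherian_ring TYPE('a::comm_ring_1)" "local_ring (mm :: 'a set)"
  shows "noetherian_local (Abs_ideal mm)" and "iset (Abs_ideal mm) = mm"
proof -
  have max: "maximal_ideal mm" and uniq: "\<And>N. maximal_ideal N \<Longrightarrow> N = mm"
    using assms(2) by (auto simp: local_ring_def)
  show mm: "iset (Abs_ideal mm) = mm" using max by (simp add: maximal_ideal_def)
  have "A \<noteq> 1 \<longrightarrow> A \<le> Abs_ideal mm" for A
    using assms(1)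
  proof (induction A rule: noetherian_induct)
    case (step A)
    show ?case
    proof (cases "\<exists>B. A < B \<and> B \<noteq> 1")
      case True
      then show ?thesis using step by (metis less_imp_le order_trans)
    next
      case False
      have "maximal_ideal (iset A)" if "A \<noteq> 1"
        unfolding maximal_ideal_def
      proof (intro conjI allI impI)
        show "iset A \<noteq> UNIV" using that by (metis iset_1 iset_inject)
        fix I assume "is_ideal I \<and> iset A \<subseteq> I"
        then have I: "iset (Abs_ideal I) = I" "A \<le> Abs_ideal I" by (simp_all add: less_eq_ideal_def)
        then have "A = Abs_ideal I \<or> Abs_ideal I = 1" using False by (auto simp: order.order_iff_strict)
        then show "I = iset A \<or> I = UNIV" using I by (metis iset_1)
      qed simp
      then show ?thesis using uniq iset_inverse order_refl by metis
    qed
  qed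
  moreover have "Abs_ideal mm \<noteq> 1" using max mm by (metis iset_1 maximal_ideal_def)
  ultimately show "noetherian_local (Abs_ideal mm)"
    using assms(1) by unfold_locales blast+
qed

context noetherian_local
begin

lemma not_in_M_unit: "x \<notin> iset M \<Longrightarrow> pideal x = 1"
  using M_greatest[of "pideal x"] by (auto simp: pideal_le_iff)

lemma one_notin_M: "1 \<notin> iset M"
  using M_proper by (simp add: ideal_eq_one_iff)

lemma M_prime: "is_prime M"
proof (rule is_primeI[OF M_proper])
  fix a b assume "a \<notin> iset M" "b \<notin> iset M"
  then have "pideal (a * b) = 1" by (simp add: not_in_M_unit pideal_mult)
  then show "a * b \<notin> iset M" using M_proper ideal_one_le_iff pideal_le_iff by metis
qed

lemma prime_le_M: "is_prime P \<Longrightarrow> P \<le> M"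
  using M_greatest is_prime_not_one by blast

lemma fg: "\<exists>S. finite S \<and> A = gen S" for A :: "'a ideal"
  using noetherian_fg[OF noeth] .

lemma flen_M: "flen M 1" and ilen_M: "ilen M 1 = 1"
proof -
  have le: "n \<le> 1" if "ichain M 1 n" for n
  proof (rule ccontr)
    assume "\<not> n \<le> 1"
    then obtain k where "n = Suc (Suc k)" by (metis One_nat_def not0_implies_Suc not_less_eq_eq le0)
    then obtain C D where "ichain M C k" "C < D" "D < 1" using \<open>ichain M 1 n\<close> by (auto simp: ichain_Suc)
    then have "M < D" "D < 1" using ichain_le order.strict_trans1 by blast+
    then show False using M_greatest[of D] by (metis leD order.irrefl)
  qed
  show fl: "flen M 1" by (rule flenI[OF _ le]) simp
  have "M < 1" using M_proper by (simp add: order.strict_iff_order)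
  then show "ilen M 1 = 1" using ilen_le[OF fl le] ilen_pos[OF fl] by simp
qed

lemma flen_M_times: "flen (M * A) A"
proof -
  obtain S where S: "finite S" "A = gen S" using fg by blast
  have "M * A + gen S = A" using S(2) ideal_plus_absorb1[OF ideal_times_le2] by simp
  then show ?thesis using flen_gens[OF S(1) flen_M, of "M * A"] S(2) by simp
qed

lemma flen_M_power: "flen (M ^ n) 1"
  by (induction n) (use flen_M_times flen_trans in auto)

lemma nakayama:
  assumes "A \<le> M * A + B"
  shows "A \<le> B"
proof -
  have "A \<le> B" if "finite S" "S \<subseteq> iset A" "A \<le> gen S + B" for S
    using that
  proof (induction S rule: finite_induct)
    case (insert s S)
    let ?T = "gen S + B"
    have "M * A + B \<le> M * (pideal s + ?T) + B"
      using insert.prems(2) by (intro add_mono ideal_times_mono) (auto simp: gen_insert add.assoc)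
    also have "\<dots> \<le> pideal s * M + ?T"
      using ideal_times_le2[of M "gen S"] ideal_times_le2[of M B]
      by (auto simp: distrib_left mult.commute intro: ideal_le_plusI1 ideal_le_plusI2)
    finally have "A \<le> pideal s * M + ?T" using assms by (rule order_trans[rotated])
    moreover have "s \<in> iset A" using insert.prems(1) by simp
    ultimately have "s \<in> iset (pideal s * M + ?T)" by (rule ideal_leD)
    then obtain v t where vt: "s = v + t" "v \<in> iset (pideal s * M)" "t \<in> iset ?T"
      by (rule ideal_plus_memE)
    then obtain u where ut: "s = s * u + t" "u \<in> iset M" "t \<in> iset ?T"
      by (auto simp: iset_pideal_times)
    have "1 - u \<notin> iset M"
      using ut(2) one_notin_M iset_add[of "1 - u" M u] by auto
    then have "pideal s = pideal (s * (1 - u))" by (simp add: pideal_mult not_in_M_unit)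
    also have "s * (1 - u) = t" using ut(1) by (simp add: algebra_simps)
    finally have "pideal s \<le> ?T" using ut(3) by (simp add: pideal_le_iff)
    then have "A \<le> ?T" using insert.prems(2)
      by (simp add: gen_insert add.assoc ideal_plus_absorb1)
    then show ?case using insert by simp
  qed simp
  note elim = this
  obtain S where "finite S" "A = gen S" using fg by blast
  then show ?thesis using elim[of S] gen_mem by auto
qed

text \<open>Every element added outside \<open>B\<close> uses up at least one unit of
  length.\<close>

lemma gens_of_subquotient:
  assumes "flen B A"
  shows "\<exists>S. finite S \<and> card S \<le> ilen B A \<and> A = B + gen S"
  using assms
proof (induction "ilen B A" arbitrary: B rule: less_induct)
  case less
  show ?case
  proof (cases "A \<le> B")
    case True
    then have "A = B" using flen_le[OF less.prems] by simp
    then show ?thesis by (intro exI[of _ "{}"]) simp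
  next
    case False
    then obtain s where s: "s \<in> iset A" "s \<notin> iset B" by (auto simp: less_eq_ideal_def)
    let ?B = "B + pideal s"
    have B: "B < ?B" "?B \<le> A"
      using s flen_le[OF less.prems] by (auto simp: pideal_le_iff less_plus_pideal)
    have fl: "flen B ?B" "flen ?B A" using flen_sub[OF less.prems] B by auto
    have add: "ilen B A = ilen B ?B + ilen ?B A" using ilen_add[OF less.prems _ B(2)] by simp
    have pos: "0 < ilen B ?B" using ilen_pos[OF fl(1) B(1)] .
    then obtain S where S: "finite S" "card S \<le> ilen ?B A" "A = ?B + gen S"
      using less.hyps[of ?B] fl(2) add by auto
    have "A = B + gen (insert s S)" using S(3) by (simp add: gen_insert add.assoc)
    moreover have "card (insert s S) \<le> ilen B A"
      using S(1,2) add pos card_insert_le_m1[of "ilen B A" S s] by (simp add: card_insert_if)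
    ultimately show ?thesis using S(1) by (intro exI[of _ "insert s S"]) simp
  qed
qed

text \<open>Turns the number of generators into a length, to which Hilbert-Serre applies. Generators
  modulo \<open>M * A\<close> lift by Nakayama, and conversely each generator adds at most the
  length 1 of \<open>R/M\<close>.\<close>

lemma num_gens_eq: "num_gens (iset A) = ilen (M * A) A"
proof -
  have le: "ilen (M * A) A \<le> card S" if "finite S" "gen S = A" for S
  proof -
    have "M * A + gen S = A" using that(2) ideal_plus_absorb1[OF ideal_times_le2] by simp
    then show ?thesis using flen_gens[OF that(1) flen_M, of "M * A"] that(2) by (simp add: ilen_M)
  qed
  obtain S where S: "finite S" "card S \<le> ilen (M * A) A" "A = M * A + gen S"
    using gens_of_subquotient[OF flen_M_times] by blast
  have "A \<le> gen S" using nakayama S(3) order_refl by metis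
  then have "gen S = A" using S(3) by (metis antisym ideal_le_plus2)
  then have ex: "\<exists>S. finite S \<and> card S = ilen (M * A) A \<and> ideal_gen S = iset A"
    using S le by (metis antisym iset_gen)
  show ?thesis unfolding num_gens_def
  proof (rule Least_equality)
    show "\<exists>S. finite S \<and> card S = ilen (M * A) A \<and> ideal_gen S = iset A" by (rule ex)
    fix n assume "\<exists>S. finite S \<and> card S = n \<and> ideal_gen S = iset A"
    then show "ilen (M * A) A \<le> n" using le by (metis iset_gen iset_inject)
  qed
qed

subsection \<open>Hilbert polynomials\<close>

text \<open>A power of \<open>M\<close> inside \<open>K\<close> replaces the radical condition,
  because this is what makes \<open>R/K^n\<close> of finite length.\<close>

definition mprimary :: "'a ideal \<Rightarrow> bool" where
  "mprimary K \<longleftrightarrow> K \<le> M \<and> (\<exists>u. M ^ u \<le> K)"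

lemma mprimary_M: "mprimary M"
  unfolding mprimary_def by (auto intro!: exI[of _ 1])

lemma flen_mprimary_power:
  assumes "mprimary K" "K ^ n \<le> A"
  shows "flen A 1"
proof -
  obtain u where "M ^ u \<le> K" using assms(1) by (auto simp: mprimary_def)
  then have "M ^ (u * n) \<le> K ^ n" by (simp add: power_mult ideal_power_mono)
  then have "M ^ (u * n) \<le> A" using assms(2) by (rule order_trans)
  then show ?thesis using flen_sub[OF flen_M_power] by simp
qed

text \<open>Hilbert-Serre for the associated graded ring, followed by summation, which raises the
  degree by one.\<close>

lemma hilbert_samuel_gens:
  assumes "mprimary (gen S)" "finite S"
  shows "\<exists>c. evp (Suc (card S)) c (\<lambda>n. int (ilen (gen S ^ Suc n) 1))"
proof -
  let ?K = "gen S"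
  have fl: "flen (?K ^ n) 1" for n using flen_mprimary_power[OF assms(1) order_refl] .
  have "\<exists>c. evp (card S) c (\<lambda>n. int (ilen (?K ^ Suc n) (?K ^ n)))"
  proof (rule hilbert_serre[OF assms(2)])
    show "gnoeth ?K (\<lambda>n. ?K ^ Suc n) (\<lambda>n. ?K ^ n)"
      by (rule gnoeth_subquotient[OF rees_noetherian[OF noeth]]) auto
    show "flen (?K ^ Suc n) (?K ^ n)" for n
      by (rule flen_sub[OF fl[of "Suc n"]]) (simp_all add: ideal_times_le2)
  qed (auto intro: ideal_times_le2)
  then obtain c where c: "evp (card S) c (\<lambda>n. int (ilen (?K ^ Suc n) (?K ^ n)))" by blast
  show ?thesis
  proof (rule evp_antidiff[OF c])
    fix n
    have "ilen (?K ^ Suc (Suc n)) 1 = ilen (?K ^ Suc (Suc n)) (?K ^ Suc n) + ilen (?K ^ Suc n) 1"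
      using fl[of "Suc (Suc n)"] by (rule ilen_add) (auto intro: ideal_times_le2)
    then show "int (ilen (?K ^ Suc (Suc n)) 1) =
        int (ilen (?K ^ Suc n) 1) + int (ilen (?K ^ Suc (Suc n)) (?K ^ Suc n))" by simp
  qed
qed

lemma hilbert_samuel_growth:
  assumes "mprimary q" "evp (Suc k) c (\<lambda>n. int (ilen (q ^ Suc n) 1))" "u \<ge> 1"
  shows "\<exists>C. \<exists>N. \<forall>n\<ge>N. int (ilen (q ^ (u * Suc n)) 1) \<le> C * int ((n + k) choose k)"
proof -
  obtain C N where C: "C \<ge> 0" and N: "\<And>n. n \<ge> N \<Longrightarrow> int (ilen (q ^ Suc n) 1) \<le> C * int ((n + k) choose k)"
    using evp_bound[OF assms(2)] by blast
  \<comment> \<open>For \<open>n \<ge> 1\<close> the exponent \<open>u (n + 1)\<close> is at most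
    \<open>2 u n + 1\<close>, the exponent that belongs to index \<open>2 u n\<close>;
    \<open>choose_scale\<close> then absorbs the factor \<open>2 u\<close>.\<close>
  have "int (ilen (q ^ (u * Suc n)) 1) \<le> (C * int ((2 * u) ^ k)) * int ((n + k) choose k)"
    if n: "n \<ge> max 1 N" for n
  proof -
    have "u * 1 \<le> u * n" "1 * n \<le> u * n" using n assms(3) by (intro mult_le_mono; simp)+
    moreover have "u * Suc n = u * n + u" "2 * u * n = u * n + u * n" "N \<le> n"
      using n by (simp_all add: algebra_simps)
    ultimately have un: "u * Suc n \<le> Suc (2 * u * n)" "N \<le> 2 * u * n" by linarith+
    have "ilen (q ^ (u * Suc n)) 1 \<le> ilen (q ^ Suc (2 * u * n)) 1"
      using flen_mprimary_power[OF assms(1) order_refl] ideal_power_antimono[OF un(1)]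
      by (rule ilen_mono) simp_all
    then have "int (ilen (q ^ (u * Suc n)) 1) \<le> C * int ((2 * u * n + k) choose k)"
      using N[OF un(2)] by linarith
    also have "\<dots> \<le> C * int ((2 * u) ^ k * ((n + k) choose k))"
      using C choose_scale[of "2 * u" n k] assms(3) by (intro mult_left_mono) (auto simp del: of_nat_mult)
    finally show ?thesis by simp
  qed
  then show ?thesis by blast
qed

text \<open>Generators of \<open>K\<close> provide a polynomial of possibly too large degree. Since
  a power of \<open>gen S\<close> lies in \<open>K\<close>, its growth is bounded by that of a
  polynomial of degree \<open>card S\<close>.\<close>

theorem hilbert_samuel:
  assumes "mprimary K" "mprimary (gen S)" "finite S"
  shows "\<exists>c. evp (Suc (card S)) c (\<lambda>n. int (ilen (K ^ Suc n) 1))"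
proof -
  obtain T where T: "finite T" "K = gen T" using fg by blast
  obtain c where c: "evp (Suc (card T)) c (\<lambda>n. int (ilen (K ^ Suc n) 1))"
    using hilbert_samuel_gens[of T] assms(1) T by auto
  obtain u where "M ^ u \<le> K" using assms(1) by (auto simp: mprimary_def)
  \<comment> \<open>Passing to \<open>Suc u\<close> supplies the positive stretch factor that
    \<open>hilbert_samuel_growth\<close> asks for.\<close>
  then have "M ^ Suc u \<le> K" using ideal_power_antimono[of u "Suc u" M] by (meson le_SucI order_refl order_trans)
  then have u: "gen S ^ Suc u \<le> K"
    using ideal_power_mono[of "gen S" M "Suc u"] assms(2) order_trans unfolding mprimary_def by blast
  obtain e where "evp (Suc (card S)) e (\<lambda>n. int (ilen (gen S ^ Suc n) 1))"
    using hilbert_samuel_gens[OF assms(2,3)] by blast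
  from hilbert_samuel_growth[OF assms(2) this, of "Suc u"]
  obtain C N where CN: "\<And>n. n \<ge> N \<Longrightarrow>
      int (ilen (gen S ^ (Suc u * Suc n)) 1) \<le> C * int ((n + card S) choose card S)" by auto
  have le: "int (ilen (K ^ Suc n) 1) \<le> C * int ((n + card S) choose card S)" if "n \<ge> N" for n
  proof -
    have "gen S ^ (Suc u * Suc n) \<le> K ^ Suc n"
      unfolding power_mult by (rule ideal_power_mono[OF u])
    with flen_mprimary_power[OF assms(2) order_refl]
    have "ilen (K ^ Suc n) 1 \<le> ilen (gen S ^ (Suc u * Suc n)) 1" by (rule ilen_mono) simp_all
    then show ?thesis using CN[OF that] by linarith
  qed
  show ?thesis by (rule evp_dominated[OF c _ le]) simp_all
qed

subsection \<open>Dimension\<close>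

definition pchain :: "nat \<Rightarrow> (nat \<Rightarrow> 'a ideal) \<Rightarrow> bool" where
  "pchain r Q \<longleftrightarrow> (\<forall>i\<le>r. is_prime (Q i)) \<and> (\<forall>i<r. Q i < Q (Suc i))"

text \<open>With \<open>B = P + K^(n+c)\<close>, split \<open>R/B\<close> at \<open>xR + B\<close>.
  The upper part has length at least that of \<open>R/(P' + K^(n+c))\<close>. The lower part is
  \<open>R/(B : x)\<close>, and Artin-Rees together with \<open>x\<close> being a nonzerodivisor
  modulo \<open>P\<close> places \<open>B : x\<close> inside \<open>P + K^n\<close>.\<close>

lemma length_drop:
  assumes "is_prime P" "x \<notin> iset P" "P + pideal x \<le> P'" "mprimary K"
  shows "\<exists>c. \<forall>n. ilen (P' + K ^ (n + c)) 1 + ilen (P + K ^ n) 1 \<le> ilen (P + K ^ (n + c)) 1"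
proof -
  obtain c where c: "\<And>n. inf (K ^ (n + c)) (P + pideal x) \<le> K ^ n * (P + pideal x)"
    using artin_rees[OF noeth] by blast
  have "ilen (P' + K ^ (n + c)) 1 + ilen (P + K ^ n) 1 \<le> ilen (P + K ^ (n + c)) 1" for n
  proof -
    let ?B = "P + K ^ (n + c)"
    have fl: "flen ?B 1" using flen_mprimary_power[OF assms(4) ideal_le_plus2] .
    have "?B \<le> pideal x * 1 + ?B" by simp
    then have "ilen ?B 1 = ilen ?B (pideal x * 1 + ?B) + ilen (pideal x * 1 + ?B) 1"
      by (intro ilen_add[OF fl]) simp_all
    moreover have "ilen (P' + K ^ (n + c)) 1 \<le> ilen (pideal x * 1 + ?B) 1"
      using assms(3) by (intro ilen_mono flen_sub[OF fl]) (auto intro: ideal_le_plusI1)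
    moreover have "ilen (P + K ^ n) 1 \<le> ilen ?B (pideal x * 1 + ?B)"
      unfolding ilen_mult_eq
    proof (rule ilen_mono)
      show "flen (inf 1 (icolon ?B (pideal x))) 1"
        unfolding flen_mult_iff by (rule flen_sub[OF fl]) simp_all
      show "inf 1 (icolon ?B (pideal x)) \<le> P + K ^ n"
      proof (rule ideal_leI)
        fix z assume "z \<in> iset (inf 1 (icolon ?B (pideal x)))"
        then have "x * z \<in> iset ?B" by (simp add: mem_icolon_pideal del: iset_icolon)
        then obtain p k where pk: "x * z = p + k" "p \<in> iset P" "k \<in> iset (K ^ (n + c))"
          by (rule ideal_plus_memE)
        have k: "k = (- p) + x * z" using pk by simp
        have "k \<in> iset (P + pideal x)"
          unfolding k using pk(2) by (intro ideal_plus_memI iset_uminus iset_mult2 pideal_mem)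
        then have "k \<in> iset (K ^ n * (P + pideal x))" using pk(3) c ideal_leD by (metis IntI iset_inf)
        moreover have "K ^ n * (P + pideal x) \<le> P + pideal x * K ^ n"
          using ideal_times_le2[of "K ^ n" P]
          by (auto simp: distrib_left mult.commute intro: ideal_le_plusI1 ideal_le_plusI2)
        ultimately have "k \<in> iset (P + pideal x * K ^ n)" using ideal_leD by blast
        then obtain p' k' where pk': "k = p' + x * k'" "p' \<in> iset P" "k' \<in> iset (K ^ n)"
          by (auto elim!: ideal_plus_memE simp: iset_pideal_times)
        have "x * (z - k') = p + p'" using pk pk' by (simp add: algebra_simps)
        then have "x * (z - k') \<in> iset P" using pk pk' by auto
        then have "z - k' \<in> iset P" using assms(1,2) is_prime_mem by blast
        then have "(z - k') + k' \<in> iset (P + K ^ n)" using pk'(3) by (rule ideal_plus_memI)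
        then show "z \<in> iset (P + K ^ n)" by simp
      qed
    qed simp_all
    ultimately show ?thesis by simp
  qed
  then show ?thesis by blast
qed

text \<open>Each further prime adds one order of growth: \<open>length_drop\<close> bounds the
  increments from below by the previous binomials, and Pascal's rule sums them.\<close>

lemma prime_chain_growth:
  assumes "pchain r Q" "mprimary K"
  shows "\<exists>C\<ge>1. \<forall>n. (n + r) choose r \<le> ilen (Q 0 + K ^ (C * Suc n)) 1"
  using assms(1)
proof (induction r arbitrary: Q)
  case 0
  have "0 < ilen (Q 0 + K ^ Suc n) 1" for n
  proof (rule ilen_pos)
    show "flen (Q 0 + K ^ Suc n) 1" using flen_mprimary_power[OF assms(2)] by (meson ideal_le_plus2)
    have "Q 0 \<le> M" using 0 prime_le_M by (auto simp: pchain_def)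
    moreover have "K ^ Suc n \<le> M"
      using assms(2) order_trans[OF ideal_times_le1, of K M] by (simp add: mprimary_def)
    ultimately have "Q 0 + K ^ Suc n \<le> M" by simp
    then show "Q 0 + K ^ Suc n < 1" using M_proper by (metis ideal_le_one ideal_one_le_iff order.strict_iff_order)
  qed
  then show ?case by (intro exI[of _ 1]) (simp add: Suc_le_eq)
next
  case (Suc r)
  have "pchain r (\<lambda>i. Q (Suc i))" using Suc.prems by (auto simp: pchain_def)
  then obtain C where C: "C \<ge> 1" "\<And>n. (n + r) choose r \<le> ilen (Q 1 + K ^ (C * Suc n)) 1"
    using Suc.IH[of "\<lambda>i. Q (Suc i)"] by auto
  have Q: "is_prime (Q 0)" "Q 0 < Q 1" using Suc.prems by (auto simp: pchain_def)
  then obtain x where x: "x \<in> iset (Q 1)" "x \<notin> iset (Q 0)" using ideal_less_ex by blast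
  then have "Q 0 + pideal x \<le> Q 1" using Q by (simp add: pideal_le_iff)
  then obtain c where c: "\<And>n. ilen (Q 1 + K ^ (n + c)) 1 + ilen (Q 0 + K ^ n) 1 \<le> ilen (Q 0 + K ^ (n + c)) 1"
    using length_drop[OF Q(1) x(2) _ assms(2)] by blast
  \<comment> \<open>\<open>D \<ge> c\<close> lets one step in \<open>n\<close> absorb the Artin-Rees
    shift, and \<open>D \<ge> C\<close> makes the inductive bound for \<open>Q 1\<close>
    applicable.\<close>
  define D where "D = C * Suc c"
  have D: "C \<le> D" "c \<le> D" "1 \<le> D"
    using C(1) mult_le_mono1[OF C(1), of "Suc c"] by (simp_all add: D_def)
  have mono: "ilen (P + K ^ m) 1 \<le> ilen (P + K ^ n) 1" if "m \<le> n" for P m n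
  proof (rule ilen_mono)
    show "flen (P + K ^ n) 1" using flen_mprimary_power[OF assms(2)] by (meson ideal_le_plus2)
    show "P + K ^ n \<le> P + K ^ m" by (intro add_left_mono ideal_power_antimono that)
  qed simp_all
  have "(n + Suc r) choose Suc r \<le> ilen (Q 0 + K ^ (D * Suc n)) 1" for n
  proof (induction n)
    case 0
    have pos: "1 \<le> ilen (Q 1 + K ^ C) 1" using C(2)[of 0] by simp
    have "ilen (Q 1 + K ^ C) 1 \<le> ilen (Q 0 + K ^ D) 1"
    proof (rule ilen_mono)
      show "flen (Q 0 + K ^ D) 1" using flen_mprimary_power[OF assms(2)] by (meson ideal_le_plus2)
      show "Q 0 + K ^ D \<le> Q 1 + K ^ C"
        using Q(2) ideal_power_antimono[OF D(1)] by (auto intro: ideal_le_plusI1 ideal_le_plusI2)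
    qed simp_all
    then show ?case using pos by simp
  next
    case (Suc n)
    let ?m = "D * Suc (Suc n) - c"
    have m: "?m + c = D * Suc (Suc n)" "D * Suc n \<le> ?m" using D by auto
    have "(Suc n + r) choose r \<le> ilen (Q 1 + K ^ (C * Suc (Suc n))) 1" by (rule C(2))
    also have "\<dots> \<le> ilen (Q 1 + K ^ (?m + c)) 1"
      unfolding m(1) using D(1) by (intro mono mult_le_mono1)
    finally have "((Suc n + r) choose r) + ((n + Suc r) choose Suc r) \<le>
        ilen (Q 1 + K ^ (?m + c)) 1 + ilen (Q 0 + K ^ ?m) 1"
      using Suc mono[OF m(2), of "Q 0"] by linarith
    also have "\<dots> \<le> ilen (Q 0 + K ^ (D * Suc (Suc n))) 1" using c[of ?m] by (simp only: m(1))
    finally show ?case by simp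
  qed
  then show ?case using D(3) by blast
qed

text \<open>The chain forces growth of order \<open>n^r\<close>, while \<open>card S\<close>
  generators allow at most order \<open>n^(card S)\<close>; for larger \<open>r\<close> the
  coefficients in degree \<open>r\<close> would give \<open>1 \<le> 0\<close>.\<close>

lemma prime_chain_bound:
  assumes "pchain r Q" "mprimary (gen S)" "finite S"
  shows "r \<le> card S"
proof (rule ccontr)
  let ?k = "card S"
  assume "\<not> r \<le> ?k"
  then have k: "Suc ?k \<le> Suc r" "?k \<noteq> r" by auto
  obtain C where C: "C \<ge> 1" "\<And>n. (n + r) choose r \<le> ilen (Q 0 + gen S ^ (C * Suc n)) 1"
    using prime_chain_growth[OF assms(1,2)] by blast
  obtain c where "evp (Suc ?k) c (\<lambda>n. int (ilen (gen S ^ Suc n) 1))"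
    using hilbert_samuel_gens[OF assms(2,3)] by blast
  from hilbert_samuel_growth[OF assms(2) this C(1)]
  obtain E N where N: "\<And>n. n \<ge> N \<Longrightarrow> int (ilen (gen S ^ (C * Suc n)) 1) \<le> E * int ((n + ?k) choose ?k)"
    by blast
  have le: "1 * int ((n + r) choose r) \<le> E * int ((n + ?k) choose ?k)" if "n \<ge> N" for n
  proof -
    have "ilen (Q 0 + gen S ^ (C * Suc n)) 1 \<le> ilen (gen S ^ (C * Suc n)) 1"
      using flen_mprimary_power[OF assms(2) order_refl] by (intro ilen_mono) auto
    then show ?thesis using C(2)[of n] N[OF that] by linarith
  qed
  from evp_lead_mono[OF evp_monomial evp_pad[OF evp_monomial k(1)] le, where N=N]
  show False using k by (simp split: if_splits)
qed

lemma krull_dim_eq: "krull_dim TYPE('a) = (GREATEST n. \<exists>Q. pchain n Q)"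
proof -
  have "(\<exists>P :: nat \<Rightarrow> 'a set. (\<forall>i\<le>n. prime_ideal (P i)) \<and> (\<forall>i<n. P i \<subset> P (Suc i))) \<longleftrightarrow> (\<exists>Q. pchain n Q)" for n
  proof
    assume "\<exists>P :: nat \<Rightarrow> 'a set. (\<forall>i\<le>n. prime_ideal (P i)) \<and> (\<forall>i<n. P i \<subset> P (Suc i))"
    then obtain P :: "nat \<Rightarrow> 'a set" where P: "\<forall>i\<le>n. prime_ideal (P i)" "\<forall>i<n. P i \<subset> P (Suc i)" by blast
    then have "\<forall>i\<le>n. iset (Abs_ideal (P i)) = P i" by (auto simp: prime_ideal_def)
    then show "\<exists>Q. pchain n Q"
      using P by (intro exI[of _ "\<lambda>i. Abs_ideal (P i)"]) (auto simp: pchain_def less_ideal_def)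
  next
    assume "\<exists>Q. pchain n Q"
    then obtain Q where "pchain n Q" by blast
    then show "\<exists>P :: nat \<Rightarrow> 'a set. (\<forall>i\<le>n. prime_ideal (P i)) \<and> (\<forall>i<n. P i \<subset> P (Suc i))"
      by (intro exI[of _ "\<lambda>i. iset (Q i)"]) (auto simp: pchain_def less_ideal_def)
  qed
  then show ?thesis unfolding krull_dim_def by simp
qed

text \<open>The \<open>GREATEST\<close> in \<open>krull_dim\<close> is meaningful only because chains of primes are bounded.\<close>

lemma krull_dim_chain: "\<exists>Q. pchain (krull_dim TYPE('a)) Q"
  and krull_dim_ge: "pchain n Q \<Longrightarrow> n \<le> krull_dim TYPE('a)"
proof -
  obtain S where "finite S" "M = gen S" using fg by blast
  then have bound: "n \<le> card S" if "\<exists>Q. pchain n Q" for n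
    using prime_chain_bound mprimary_M that by blast
  have ex: "\<exists>Q. pchain 0 Q" using M_prime by (auto simp: pchain_def)
  show "\<exists>Q. pchain (krull_dim TYPE('a)) Q"
    unfolding krull_dim_eq using bound ex by (rule GreatestI_nat[rotated])
  show "n \<le> krull_dim TYPE('a)" if "pchain n Q"
    unfolding krull_dim_eq using bound that by (intro Greatest_le_nat) blast+
qed

section \<open>Heights, prime avoidance and systems of parameters\<close>

definition height_ge :: "'a ideal \<Rightarrow> nat \<Rightarrow> bool" where
  "height_ge P i \<longleftrightarrow> (\<exists>Q. pchain i Q \<and> Q i = P)"

lemma height_ge_Suc:
  assumes "height_ge P i" "P < P'" "is_prime P'"
  shows "height_ge P' (Suc i)"
proof -
  obtain Q where "pchain i Q" "Q i = P" using assms(1) by (auto simp: height_ge_def)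
  then show ?thesis unfolding height_ge_def
    using assms(2,3) by (intro exI[of _ "Q(Suc i := P')"]) (auto simp: pchain_def less_Suc_eq le_Suc_eq)
qed

lemma height_ge_mono:
  assumes "height_ge P i" "j \<le> i"
  shows "height_ge P j"
proof -
  obtain Q where Q: "pchain i Q" "Q i = P" using assms(1) by (auto simp: height_ge_def)
  have "pchain j (\<lambda>k. Q (k + (i - j)))"
    using Q(1) assms(2) unfolding pchain_def by auto
  then show ?thesis using Q(2) assms(2) unfolding height_ge_def
    by (intro exI[of _ "\<lambda>k. Q (k + (i - j))"]) simp
qed

lemma height_ge_dim_eq_M:
  assumes "height_ge P (krull_dim TYPE('a))"
  shows "P = M"
proof (rule ccontr)
  assume "P \<noteq> M"
  moreover have "P \<le> M" using assms prime_le_M by (auto simp: height_ge_def pchain_def)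
  ultimately have "height_ge M (Suc (krull_dim TYPE('a)))"
    using height_ge_Suc[OF assms] M_prime by (auto simp: order.strict_iff_order)
  then show False using krull_dim_ge by (auto simp: height_ge_def dest: Suc_le_lessD)
qed

lemma height_ge_M: "height_ge M (krull_dim TYPE('a))"
  using krull_dim_chain height_ge_dim_eq_M unfolding height_ge_def by metis

text \<open>Stands in for the finiteness of minimal primes. If \<open>a * b\<close> lies in
  \<open>A\<close>, each prime over \<open>A\<close> lies over \<open>A + (a)\<close> or
  \<open>A + (b)\<close>, and Noetherian induction joins the two finite families.\<close>

lemma finite_prime_cover:
  fixes A :: "'a ideal"
  shows "\<exists>F. finite F \<and> (\<forall>P\<in>F. is_prime P \<and> A \<le> P) \<and> (\<forall>P. is_prime P \<longrightarrow> A \<le> P \<longrightarrow> (\<exists>Q\<in>F. Q \<le> P))"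
  using noeth
proof (induction A rule: noetherian_induct)
  case (step A)
  consider "is_prime A" | "A = 1" | a b where "a \<notin> iset A" "b \<notin> iset A" "a * b \<in> iset A"
    using is_primeI by blast
  then show ?case
  proof cases
    case 1
    then show ?thesis by (intro exI[of _ "{A}"]) auto
  next
    case 2
    then show ?thesis by (intro exI[of _ "{}"]) (auto simp: ideal_one_le_iff dest: is_prime_not_one)
  next
    case 3
    have lt: "A < A + pideal a" "A < A + pideal b"
      using 3(1,2) less_plus_pideal by auto
    obtain F where F: "finite F" "\<forall>P\<in>F. is_prime P \<and> A + pideal a \<le> P"
        "\<forall>P. is_prime P \<longrightarrow> A + pideal a \<le> P \<longrightarrow> (\<exists>Q\<in>F. Q \<le> P)" using step[OF lt(1)] by blast
    obtain G where G: "finite G" "\<forall>P\<in>G. is_prime P \<and> A + pideal b \<le> P"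
        "\<forall>P. is_prime P \<longrightarrow> A + pideal b \<le> P \<longrightarrow> (\<exists>Q\<in>G. Q \<le> P)" using step[OF lt(2)] by blast
    have "\<exists>Q\<in>F \<union> G. Q \<le> P" if "is_prime P" "A \<le> P" for P
    proof -
      have "a \<in> iset P \<or> b \<in> iset P" using 3(3) that is_prime_mem ideal_leD by blast
      then show ?thesis using F(3) G(3) that by (auto simp: pideal_le_iff)
    qed
    then show ?thesis using F(1,2) G(1,2) by (intro exI[of _ "F \<union> G"]) auto
  qed
qed

text \<open>After discarding primes below others, take \<open>x\<close> avoiding all but one prime
  \<open>P\<close>. Should \<open>x\<close> lie in \<open>P\<close>, add an element outside
  \<open>P\<close> of the product of \<open>A\<close> with the other primes.\<close>

lemma prime_avoidance:
  assumes "finite F" "\<And>P. P \<in> F \<Longrightarrow> is_prime P \<and> \<not> A \<le> P"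
  shows "\<exists>x\<in>iset A. \<forall>P\<in>F. x \<notin> iset P"
  using assms
proof (induction "card F" arbitrary: F rule: less_induct)
  case less
  show ?case
  proof (cases "\<exists>P\<in>F. \<exists>Q\<in>F. Q < P")
    case True
    then obtain P Q where PQ: "P \<in> F" "Q \<in> F" "Q < P" by blast
    have "card (F - {Q}) < card F" using PQ less.prems(1) by (meson card_Diff1_less)
    from less.hyps[OF this] less.prems obtain x where x: "x \<in> iset A" "\<forall>P\<in>F - {Q}. x \<notin> iset P" by auto
    moreover have "x \<notin> iset Q" using x(2) PQ ideal_leD by (metis DiffI less_imp_le order.irrefl singletonD)
    ultimately show ?thesis by auto
  next
    case anti: False
    show ?thesis
    proof (cases "F = {}")
      case True
      then show ?thesis by (intro bexI[of _ 0]) auto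
    next
      case False
      then obtain P where P: "P \<in> F" by blast
      have "card (F - {P}) < card F" using P less.prems(1) by (meson card_Diff1_less)
      from less.hyps[OF this] less.prems obtain x where x: "x \<in> iset A" "\<forall>Q\<in>F - {P}. x \<notin> iset Q" by auto
      have pr: "is_prime P" "\<not> A \<le> P" using less.prems(2) P by auto
      have "\<not> (\<Prod>Q\<in>G. Q) \<le> P" if "G \<subseteq> F - {P}" for G
        using finite_subset[OF that] that less.prems(1)
      proof (induction G rule: infinite_finite_induct)
        case (insert Q G)
        have "\<not> Q \<le> P" using insert.prems anti P by (auto simp: order.order_iff_strict)
        then show ?case using insert is_prime_mult_le[OF pr(1), of Q "\<Prod>Q\<in>G. Q"] by auto
      qed (auto simp: ideal_one_le_iff is_prime_not_one[OF pr(1)])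
      then have "\<not> A * (\<Prod>Q\<in>F - {P}. Q) \<le> P" using is_prime_mult_le[OF pr(1)] pr(2) by blast
      then obtain z where z: "z \<in> iset (A * (\<Prod>Q\<in>F - {P}. Q))" "z \<notin> iset P" by (auto simp: less_eq_ideal_def)
      have zA: "z \<in> iset A" using z(1) ideal_times_le1 ideal_leD by blast
      have zQ: "z \<in> iset Q" if "Q \<in> F - {P}" for Q
      proof -
        have "(\<Prod>Q\<in>F - {P}. Q) = Q * (\<Prod>Q\<in>F - {P} - {Q}. Q)"
          using that less.prems(1) by (intro prod.remove) auto
        then have "A * (\<Prod>Q\<in>F - {P}. Q) \<le> Q" using ideal_times_le1 ideal_times_le2 order_trans by metis
        then show ?thesis using z(1) ideal_leD by blast
      qed
      show ?thesis
      proof (cases "x \<in> iset P")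
        case True
        have "x + z \<notin> iset Q" if "Q \<in> F" for Q
        proof
          assume h: "x + z \<in> iset Q"
          show False
          proof (cases "Q = P")
            case True
            then have "(x + z) - x \<in> iset P" using h \<open>x \<in> iset P\<close> by blast
            then show False using z by simp
          next
            case False
            then have "(x + z) - z \<in> iset Q" using h zQ that by blast
            then show False using x(2) False that by simp
          qed
        qed
        then show ?thesis using x(1) zA by blast
      qed (use x in auto)
    qed
  qed
qed

text \<open>If \<open>a * b\<close> lies in \<open>A\<close>, then
  \<open>(A + (a)) (A + (b))\<close> lies in \<open>A\<close>, so the exponents obtained for the two
  larger ideals add up.\<close>

lemma M_power_le:
  fixes A :: "'a ideal"
  assumes "\<And>P. is_prime P \<Longrightarrow> A \<le> P \<Longrightarrow> P = M"
  shows "\<exists>u. M ^ u \<le> A"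
  using noeth assms
proof (induction A rule: noetherian_induct)
  case (step A)
  consider "is_prime A" | "A = 1" | a b where "a \<notin> iset A" "b \<notin> iset A" "a * b \<in> iset A"
    using is_primeI by blast
  then show ?case
  proof cases
    case 1
    then show ?thesis using step.prems by (intro exI[of _ 1]) simp
  next
    case 2
    then show ?thesis by simp
  next
    case 3
    have lt: "A < A + pideal a" "A < A + pideal b"
      using 3(1,2) less_plus_pideal by auto
    obtain u v where uv: "M ^ u \<le> A + pideal a" "M ^ v \<le> A + pideal b"
      using step.IH[OF lt(1)] step.IH[OF lt(2)] step.prems by auto
    have "M ^ (u + v) \<le> (A + pideal a) * (A + pideal b)"
      using ideal_times_mono[OF uv] by (simp add: power_add)
    also have "\<dots> \<le> A"
      using 3(3) ideal_times_le1[of A] ideal_times_le2[of _ A]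
      by (simp add: distrib_left distrib_right pideal_mult[symmetric] pideal_le_iff[of "a * b"])
    finally show ?thesis by blast
  qed
qed

text \<open>Each new element avoids the finitely many covering primes of the ideal so far, except
  \<open>M\<close>, so that every prime containing it has height one more. The prime
  \<open>M\<close> may be excepted because it has height at least \<open>d\<close> anyway; after
  \<open>d\<close> elements it is the only prime left.\<close>

theorem system_of_parameters:
  "\<exists>S. finite S \<and> card S \<le> krull_dim TYPE('a) \<and> mprimary (gen S)"
proof -
  let ?d = "krull_dim TYPE('a)"
  have "\<exists>S. finite S \<and> card S \<le> i \<and> S \<subseteq> iset M \<and> (\<forall>P. is_prime P \<longrightarrow> S \<subseteq> iset P \<longrightarrow> height_ge P i)"
    if "i \<le> ?d" for i
    using that
  proof (induction i)
    case 0
    have "height_ge P 0" if "is_prime P" for P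
      using that by (auto simp: height_ge_def pchain_def intro: exI[of _ "\<lambda>_. P"])
    then show ?case by (intro exI[of _ "{}"]) auto
  next
    case (Suc i)
    then obtain S where S: "finite S" "card S \<le> i" "S \<subseteq> iset M"
        "\<And>P. is_prime P \<Longrightarrow> S \<subseteq> iset P \<Longrightarrow> height_ge P i" by auto
    obtain F where F: "finite F" "\<And>P. P \<in> F \<Longrightarrow> is_prime P \<and> gen S \<le> P"
        "\<And>P. is_prime P \<Longrightarrow> gen S \<le> P \<Longrightarrow> \<exists>Q\<in>F. Q \<le> P"
      using finite_prime_cover[of "gen S"] by blast
    have "is_prime P \<and> \<not> M \<le> P" if "P \<in> F - {M}" for P
      using that F(2) prime_le_M by (auto intro: antisym)
    then obtain x where x: "x \<in> iset M" "\<And>P. P \<in> F - {M} \<Longrightarrow> x \<notin> iset P"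
      using prime_avoidance[of "F - {M}" M] F(1) by auto
    have "height_ge P (Suc i)" if P: "is_prime P" "insert x S \<subseteq> iset P" for P
    proof -
      obtain Q where Q: "Q \<in> F" "Q \<le> P" using F(3)[OF P(1)] P(2) by (auto simp: gen_le_iff)
      show ?thesis
      proof (cases "Q = M")
        case True
        then have "P = M" using Q(2) prime_le_M[OF P(1)] by simp
        then show ?thesis using height_ge_mono[OF height_ge_M Suc.prems] by simp
      next
        case False
        then have "x \<notin> iset Q" using x(2) Q(1) by auto
        then have "Q < P" using Q(2) P(2) by (auto simp: order.strict_iff_order)
        moreover have "height_ge Q i" using S(4) F(2)[OF Q(1)] by (auto simp: gen_le_iff)
        ultimately show ?thesis using height_ge_Suc P(1) by blast
      qed
    qed
    then show ?case using S x(1) by (intro exI[of _ "insert x S"]) (auto simp: card_insert_if)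
  qed
  from this[OF order_refl] obtain S where S: "finite S" "card S \<le> ?d" "S \<subseteq> iset M"
      "\<And>P. is_prime P \<Longrightarrow> S \<subseteq> iset P \<Longrightarrow> height_ge P ?d" by blast
  have "\<exists>u. M ^ u \<le> gen S"
    using S(4) height_ge_dim_eq_M by (intro M_power_le) (auto simp: gen_le_iff)
  then show ?thesis using S(1-3) by (auto simp: mprimary_def gen_le_iff)
qed

end

section \<open>Reductions\<close>

text \<open>Separates the pure power of \<open>B\<close> from everything with a factor
  \<open>A\<close>. It serves integral equations, the recursion on monomials and the step of the
  filtration alike.\<close>

lemma power_sum_ideal: "(A + B) ^ Suc j = A * (A + B) ^ j + B ^ Suc j" for A B :: "'a::comm_ring_1 ideal"
proof (induction j)
  case (Suc j)
  have "B * (A * (A + B) ^ j) \<le> A * (A + B) ^ Suc j"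
    using ideal_times_mono[OF order_refl, of "B * (A + B) ^ j" "(A + B) * (A + B) ^ j" A]
    by (simp add: mult.left_commute distrib_right)
  then have absorb: "A * (A + B) ^ Suc j + B * (A * (A + B) ^ j) = A * (A + B) ^ Suc j"
    by (rule ideal_plus_absorb2)
  have "(A + B) ^ Suc (Suc j) = A * (A + B) ^ Suc j + B * (A + B) ^ Suc j"
    by (simp only: power_Suc distrib_right)
  also have "B * (A + B) ^ Suc j = B * (A * (A + B) ^ j) + B ^ Suc (Suc j)"
    by (subst Suc) (simp add: distrib_left)
  also have "A * (A + B) ^ Suc j + (B * (A * (A + B) ^ j) + B ^ Suc (Suc j)) =
      A * (A + B) ^ Suc j + B ^ Suc (Suc j)"
    by (simp only: add.assoc[symmetric] absorb)
  finally show ?case .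
qed simp

text \<open>In an integral equation of degree \<open>k = j + 1\<close> every term
  \<open>a_i h^(k-i)\<close> with \<open>i \<ge> 1\<close> contains at least one factor from
  \<open>J\<close>, and the remaining \<open>j\<close> factors lie in
  \<open>J + (h)\<close>.\<close>

lemma integral_power_mem:
  assumes "integral_over_ideal (iset J) h"
  shows "\<exists>j. h ^ Suc j \<in> iset (J * (J + pideal h) ^ j)"
proof -
  obtain k a where k: "k \<ge> 1" "\<forall>i\<in>{1..k}. a i \<in> iset (J ^ i)"
      "h ^ k + (\<Sum>i=1..k. a i * h ^ (k - i)) = 0"
    using assms unfolding integral_over_ideal_def iset_power by blast
  obtain j where j: "k = Suc j" using k(1) by (cases k) auto
  let ?B = "J + pideal h"
  have "a i * h ^ (k - i) \<in> iset (J * ?B ^ j)" if i: "i \<in> {1..k}" for i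
  proof -
    obtain l where l: "i = Suc l" using i by (cases i) auto
    have "h ^ (k - i) \<in> iset (?B ^ (k - i))"
      using pideal_mem[of "h ^ (k - i)"] ideal_power_mono[OF ideal_le_plus2[of "pideal h" J], of "k - i"] ideal_leD
      unfolding pideal_power by blast
    then have "a i * h ^ (k - i) \<in> iset (J ^ i * ?B ^ (k - i))"
      using k(2) i by (intro times_memI) auto
    moreover have "J ^ i * ?B ^ (k - i) \<le> J * (?B ^ l * ?B ^ (k - i))"
      unfolding l power_Suc mult.assoc by (intro ideal_times_mono ideal_power_mono) auto
    moreover have "?B ^ l * ?B ^ (k - i) = ?B ^ j"
      using i by (simp add: l j power_add[symmetric])
    ultimately show ?thesis using ideal_leD by metis
  qed
  then have "(\<Sum>i\<in>X. a i * h ^ (k - i)) \<in> iset (J * ?B ^ j)" if "X \<subseteq> {1..k}" for X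
    using finite_subset[OF that] that by (induction X rule: infinite_finite_induct) auto
  then have "- (\<Sum>i=1..k. a i * h ^ (k - i)) \<in> iset (J * ?B ^ j)" by blast
  moreover have "h ^ k = - (\<Sum>i=1..k. a i * h ^ (k - i))" using k(3) by (simp add: eq_neg_iff_add_eq_0)
  ultimately show ?thesis unfolding j by metis
qed

definition is_reduction :: "'a::comm_ring_1 ideal \<Rightarrow> 'a ideal \<Rightarrow> nat \<Rightarrow> bool" where
  "is_reduction J I s \<longleftrightarrow> I ^ Suc s = J * I ^ s"

lemma is_reduction_power: "is_reduction J I s \<Longrightarrow> I ^ (j + s) = J ^ j * I ^ s"
proof (induction j)
  case (Suc j)
  have "I ^ (Suc j + s) = I * (J ^ j * I ^ s)" using Suc by simp
  also have "\<dots> = J ^ j * I ^ Suc s" by (simp add: mult.left_commute)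
  also have "\<dots> = J ^ Suc j * I ^ s" using Suc.prems unfolding is_reduction_def by (simp add: mult_ac)
  finally show ?case .
qed simp

lemma is_reduction_trans:
  assumes "is_reduction A B s" "is_reduction B C t"
  shows "is_reduction A C (s + t)"
proof -
  have "C ^ Suc (s + t) = B ^ Suc s * C ^ t" using is_reduction_power[OF assms(2), of "Suc s"] by simp
  also have "\<dots> = A * (B ^ s * C ^ t)" using assms(1) by (simp add: is_reduction_def mult.assoc)
  also have "B ^ s * C ^ t = C ^ (s + t)" using is_reduction_power[OF assms(2), of s] by simp
  finally show ?thesis by (simp add: is_reduction_def)
qed

lemma is_reduction_integral:
  assumes "integral_over_ideal (iset J) h"
  shows "\<exists>s. is_reduction J (J + pideal h) s"
proof -
  obtain j where "h ^ Suc j \<in> iset (J * (J + pideal h) ^ j)" using integral_power_mem[OF assms] by blast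
  then have "pideal h ^ Suc j \<le> J * (J + pideal h) ^ j"
    by (simp only: pideal_power[symmetric] pideal_le_iff)
  then show ?thesis
    unfolding is_reduction_def power_sum_ideal by (intro exI[of _ j]) (rule ideal_plus_absorb2)
qed

lemma integral_mono:
  assumes "integral_over_ideal (iset J) h" "J \<le> J'"
  shows "integral_over_ideal (iset J') h"
  using assms(1) ideal_leD[OF ideal_power_mono[OF assms(2)]]
  unfolding integral_over_ideal_def iset_power[symmetric] by blast

text \<open>The \<open>h i\<close> are adjoined one at a time. The exponent need not be minimal:
  existence is what makes the \<open>LEAST\<close> in \<open>red_num\<close> meaningful.\<close>

lemma exists_reduction:
  fixes h :: "nat \<Rightarrow> 'a::comm_ring_1"
  assumes "\<forall>i\<in>{1..m}. integral_over_ideal (iset J) (h i)"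
  shows "\<exists>s. is_reduction J (J + gen (h ` {1..m})) s"
  using assms
proof (induction m)
  case 0
  then show ?case by (auto simp: is_reduction_def)
next
  case (Suc m)
  let ?I = "J + gen (h ` {1..m})"
  obtain s where s: "is_reduction J ?I s" using Suc by auto
  obtain t where "is_reduction ?I (?I + pideal (h (Suc m))) t"
    using is_reduction_integral integral_mono[OF _ ideal_le_plus1] Suc.prems
    by (metis atLeastAtMost_iff le_add1 order_refl plus_1_eq_Suc)
  moreover have "?I + pideal (h (Suc m)) = J + gen (h ` {1..Suc m})"
    by (simp add: atLeastAtMostSuc_conv gen_insert add_ac)
  ultimately show ?case using is_reduction_trans[OF s] by metis
qed

lemma red_num_is_reduction:
  assumes "is_reduction J I s"
  shows "is_reduction J I (red_num (iset J) (iset I))"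
proof -
  have "(ideal_pow (iset I) (s + 1) = ideal_prod (iset J) (ideal_pow (iset I) s)) \<longleftrightarrow> is_reduction J I s" for s
    unfolding is_reduction_def
    by (simp only: iset_power[symmetric] iset_times[symmetric] iset_inject Suc_eq_plus1)
  then show ?thesis unfolding red_num_def using assms by (simp add: LeastI)
qed

section \<open>Counting monomial generators\<close>

text \<open>\<open>mcount m j\<close> is the number of monomials of degree \<open>j\<close> in \<open>m\<close> variables.\<close>

fun mcount :: "nat \<Rightarrow> nat \<Rightarrow> nat" where
  "mcount m 0 = 1"
| "mcount 0 (Suc j) = 0"
| "mcount (Suc m) (Suc j) = mcount m (Suc j) + mcount (Suc m) j"

text \<open>Stated for \<open>Suc m\<close> to avoid the truncated \<open>m + j - 1\<close> at
  \<open>m = 0\<close>.\<close>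

lemma mcount_Suc: "mcount (Suc m) j = (m + j) choose j"
proof (induction m arbitrary: j)
  case 0
  show ?case by (induction j) auto
next
  case (Suc m)
  note outer = this
  show ?case
  proof (induction j)
    case (Suc j)
    have "mcount (Suc (Suc m)) (Suc j) = mcount (Suc m) (Suc j) + mcount (Suc (Suc m)) j"
      by (rule mcount.simps)
    then show ?case using Suc outer[of "Suc j"] by (simp del: mcount.simps)
  qed simp
qed

text \<open>Homogenisation: monomials of degree at most \<open>s\<close> in \<open>m\<close>
  variables correspond to those of degree exactly \<open>s\<close> in \<open>m + 1\<close>.\<close>

lemma sum_mcount: "(\<Sum>j\<le>s. mcount m j) = (m + s) choose s"
proof -
  have "(\<Sum>j\<le>s. mcount m j) = mcount (Suc m) s" by (induction s) auto
  then show ?thesis by (simp add: mcount_Suc)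
qed

lemma gen_times: "gen S * gen T = gen ((\<lambda>(s, t). s * t) ` (S \<times> T))"
proof (rule antisym)
  let ?X = "gen ((\<lambda>(s, t). s * t) ` (S \<times> T))"
  have "s \<in> iset (icolon ?X (gen T))" if s: "s \<in> S" for s
  proof -
    have "gen T \<le> icolon ?X (pideal s)"
      using s by (auto simp: gen_le_iff mem_icolon_pideal simp del: iset_icolon intro!: gen_mem)
    then show ?thesis
      by (simp only: le_icolon_pideal_iff times_le_colon pideal_le_iff)
  qed
  then show "gen S * gen T \<le> ?X" unfolding times_le_colon gen_le_iff by blast
  show "?X \<le> gen S * gen T" by (auto simp: gen_le_iff intro!: times_memI gen_mem)
qed

lemma card_gen_times:
  assumes "finite S" "finite T"
  shows "\<exists>U. finite U \<and> card U \<le> card S * card T \<and> gen S * gen T = gen U"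
  using assms card_image_le[of "S \<times> T" "\<lambda>(s, t). s * t"]
  by (intro exI[of _ "(\<lambda>(s, t). s * t) ` (S \<times> T)"]) (simp add: gen_times card_cartesian_product)

text \<open>With \<open>x\<close> the last generator, \<open>(x, H)^(j+1)\<close> is
  \<open>x (x, H)^j + H^(j+1)\<close>, which is exactly the recursion of
  \<open>mcount\<close>.\<close>

lemma power_gens:
  "\<exists>T. finite T \<and> card T \<le> mcount m j \<and> gen (h ` {1..m}) ^ j = gen T" for h :: "nat \<Rightarrow> 'a::comm_ring_1"
proof (induction m j rule: mcount.induct)
  case (1 m)
  show ?case using pideal_one by (intro exI[of _ "{1}"]) (simp add: pideal_def)
next
  case (2 j)
  show ?case by (intro exI[of _ "{}"]) simp
next
  case (3 m j)
  let ?H = "gen (h ` {1..m})" and ?H' = "gen (h ` {1..Suc m})" and ?x = "h (Suc m)"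
  obtain T U where T: "finite T" "card T \<le> mcount m (Suc j)" "?H ^ Suc j = gen T"
    and U: "finite U" "card U \<le> mcount (Suc m) j" "?H' ^ j = gen U" using 3 by blast
  have H': "?H' = pideal ?x + ?H" by (simp add: atLeastAtMostSuc_conv gen_insert)
  obtain V where V: "finite V" "card V \<le> card U" "pideal ?x * gen U = gen V"
    using card_gen_times[of "{?x}" U] U(1) by (auto simp: pideal_def)
  have "?H' ^ Suc j = gen (T \<union> V)"
    using power_sum_ideal[of "pideal ?x" ?H j] unfolding H'[symmetric] U(3) T(3) V(3)
    by (simp add: gen_union add.commute)
  moreover have "card (T \<union> V) \<le> mcount (Suc m) (Suc j)"
    using card_Un_le[of T V] T(2) U(2) V(2) by simp
  ultimately show ?case using T(1) V(1) by blast
qed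

section \<open>Hilbert coefficients\<close>

lemma hilbert_sum_evp:
  "(\<exists>N. \<forall>n\<ge>N. F n = (\<Sum>i\<le>d. (-1) ^ i * e i * int ((n + d - i) choose (d - i)))) \<longleftrightarrow>
    evp (Suc d) (\<lambda>i. (-1) ^ (d - i) * e (d - i)) F"
proof -
  have "(\<Sum>i\<le>d. (-1) ^ i * e i * int ((n + d - i) choose (d - i))) =
      (\<Sum>i<Suc d. (-1) ^ (d - i) * e (d - i) * int ((n + i) choose i))" for n
    by (rule sum.reindex_bij_witness[of _ "\<lambda>i. d - i" "\<lambda>i. d - i"]) auto
  then show ?thesis by (simp add: evp_def)
qed

lemma hilbert_coeff_eq:
  fixes K :: "'a::comm_ring_1 ideal"
  assumes "evp (Suc d) c (\<lambda>n. int (ilen (K ^ Suc n) 1))" "i \<le> d"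
  shows "hilbert_coeff d (iset K) i = (-1) ^ i * c (d - i)"
proof -
  let ?F = "\<lambda>n. int (quot_length (ideal_pow (iset K) (n + 1)))"
  have F: "?F = (\<lambda>n. int (ilen (K ^ Suc n) 1))"
    by (simp only: iset_power[symmetric] quot_length_iset Suc_eq_plus1)
  define e where "e i = (if i \<le> d then (-1) ^ i * c (d - i) else 0)" for i
  have sgn: "(-1) ^ j * ((-1) ^ j * x) = (x :: int)" for j x
    by (simp add: mult.assoc[symmetric] power_mult_distrib[symmetric])
  have "evp (Suc d) (\<lambda>i. (-1) ^ (d - i) * e (d - i)) ?F"
  proof -
    have "(\<Sum>i<Suc d. (-1) ^ (d - i) * e (d - i) * int ((n + i) choose i)) =
        (\<Sum>i<Suc d. c i * int ((n + i) choose i))" for n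
      by (intro sum.cong) (auto simp: e_def sgn)
    then show ?thesis using assms(1) unfolding F evp_def by simp
  qed
  moreover have "e' = e" if e': "\<forall>i>d. e' i = 0" "evp (Suc d) (\<lambda>i. (-1) ^ (d - i) * e' (d - i)) ?F" for e'
  proof
    fix i
    show "e' i = e i"
    proof (cases "i \<le> d")
      case True
      then have "(-1) ^ i * e' i = c (d - i)"
        using evp_unique[OF e'(2)[unfolded F] assms(1), of "d - i"] by simp
      then show ?thesis using True sgn[of i "e' i"] by (simp add: e_def)
    qed (use e'(1) in \<open>simp add: e_def\<close>)
  qed
  ultimately have "hilbert_coeff d (iset K) = e"
    unfolding hilbert_coeff_def hilbert_sum_evp by (intro the_equality) (auto simp: e_def)
  then show ?thesis using assms(2) by (simp add: e_def)
qed

lemma fiber_mult_eq: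
  fixes K :: "'a::comm_ring_1 ideal"
  assumes "evp (Suc d) c (\<lambda>n. int (num_gens (iset (K ^ n))))"
  shows "fiber_mult (Suc d) (iset K) = c d"
  unfolding fiber_mult_def
proof (rule the_equality)
  show "\<exists>e N. \<forall>n\<ge>N. int (num_gens (ideal_pow (iset K) n)) =
      c d * int ((n + Suc d - 1) choose (Suc d - 1)) + (\<Sum>i<Suc d - 1. e i * int ((n + i) choose i))"
    using assms unfolding evp_def iset_power by (intro exI[of _ c]) (simp add: add.commute)
next
  fix f assume "\<exists>e N. \<forall>n\<ge>N. int (num_gens (ideal_pow (iset K) n)) =
      f * int ((n + Suc d - 1) choose (Suc d - 1)) + (\<Sum>i<Suc d - 1. e i * int ((n + i) choose i))"
  then obtain e N where eN: "\<forall>n\<ge>N. int (num_gens (iset (K ^ n))) =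
      f * int ((n + d) choose d) + (\<Sum>i<d. e i * int ((n + i) choose i))"
    unfolding iset_power by auto
  have "(\<Sum>i<d. (if i = d then f else e i) * int ((n + i) choose i)) = (\<Sum>i<d. e i * int ((n + i) choose i))" for n
    by (intro sum.cong) auto
  then have "evp (Suc d) (\<lambda>i. if i = d then f else e i) (\<lambda>n. int (num_gens (iset (K ^ n))))"
    unfolding evp_def using eN by (intro exI[of _ N]) simp
  from evp_unique[OF this assms, of d] show "f = c d" by simp
qed

section \<open>Lengths along the filtration and comparison of the first coefficients\<close>

context noetherian_local
begin

lemma prime_power_mem: "is_prime P \<Longrightarrow> x ^ k \<in> iset P \<Longrightarrow> x \<in> iset P"
proof (induction k)
  case 0
  then show ?case using is_prime_not_one by (auto simp: ideal_eq_one_iff)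
next
  case (Suc k)
  then show ?case using is_prime_mem by auto
qed

lemma mprimary_primary_to:
  assumes "primary_to (iset M) (iset J)"
  shows "mprimary J"
proof -
  have rad: "radical (iset J) = iset M" using assms by (simp add: primary_to_def)
  have "x \<in> iset M" if "x \<in> iset J" for x
    unfolding rad[symmetric] radical_def using that by (auto intro: exI[of _ 1])
  moreover have "\<exists>u. M ^ u \<le> J"
  proof (rule M_power_le)
    fix P assume P: "is_prime P" "J \<le> P"
    have "M \<le> P"
    proof (rule ideal_leI)
      fix x assume "x \<in> iset M"
      then obtain k where "x ^ k \<in> iset J" unfolding rad[symmetric] radical_def by blast
      then show "x \<in> iset P" using P prime_power_mem ideal_leD by blast
    qed
    then show "P = M" using prime_le_M[OF P(1)] by simp
  qed
  ultimately show ?thesis by (auto simp: mprimary_def intro: ideal_leI)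
qed

text \<open>A power of \<open>x\<close> lies in \<open>J\<close>, hence in the prime ideal
  \<open>M\<close>. This keeps the larger ideal proper.\<close>

lemma integral_in_M:
  assumes "integral_over_ideal (iset J) x" "J \<le> M"
  shows "x \<in> iset M"
proof -
  obtain j where "x ^ Suc j \<in> iset (J * (J + pideal x) ^ j)" using integral_power_mem[OF assms(1)] by blast
  then have "x ^ Suc j \<in> iset M" using ideal_times_le1 assms(2) ideal_leD by blast
  then show ?thesis using prime_power_mem[OF M_prime] by blast
qed

lemma hilbert_samuel_dim:
  assumes "mprimary K"
  shows "\<exists>c. evp (Suc (krull_dim TYPE('a))) c (\<lambda>n. int (ilen (K ^ Suc n) 1))"
proof -
  obtain S where S: "finite S" "card S \<le> krull_dim TYPE('a)" "mprimary (gen S)"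
    using system_of_parameters by blast
  obtain c where "evp (Suc (card S)) c (\<lambda>n. int (ilen (K ^ Suc n) 1))"
    using hilbert_samuel[OF assms S(3,1)] by blast
  from evp_pad[OF this] show ?thesis using S(2) by blast
qed

text \<open>Hilbert-Serre gives a polynomial for the fiber, and since \<open>J \<le> M\<close> it is
  dominated by the length of \<open>J^n/J^(n+1)\<close>, which has degree at most
  \<open>d\<close>.\<close>

lemma fiber_polynomial:
  assumes "mprimary J" "krull_dim TYPE('a) = Suc d"
  shows "\<exists>c. evp (Suc d) c (\<lambda>n. int (num_gens (iset (J ^ n))))"
proof -
  obtain S where S: "finite S" "J = gen S" using fg by blast
  have flJ: "flen (J ^ n) 1" for n using flen_mprimary_power[OF assms(1) order_refl] .
  have JM: "J \<le> M" using assms(1) by (simp add: mprimary_def)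
  have "\<exists>c. evp (card S) c (\<lambda>n. int (ilen (M * J ^ n) (J ^ n)))"
  proof (rule hilbert_serre[OF S(1)])
    show "gnoeth (gen S) (\<lambda>n. M * J ^ n) (\<lambda>n. J ^ n)"
      unfolding S(2)[symmetric] by (rule gnoeth_subquotient[OF rees_noetherian[OF noeth]]) auto
  qed (auto simp: S(2)[symmetric] ideal_times_le2 flen_M_times mult.left_commute)
  then obtain c where c: "evp (card S) c (\<lambda>n. int (num_gens (iset (J ^ n))))"
    by (auto simp: num_gens_eq)
  obtain e where e: "evp (Suc (Suc d)) e (\<lambda>n. int (ilen (J ^ Suc n) 1))"
    using hilbert_samuel_dim[OF assms(1)] assms(2) by auto
  let ?g = "\<lambda>n. int (ilen (J ^ Suc n) 1) - int (ilen (J ^ Suc (n - 1)) 1)"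
  \<comment> \<open>A shift preserves the leading coefficient, so the backward difference loses one
    degree.\<close>
  obtain e' where e': "evp (Suc d) e' ?g"
    using evp_drop[OF evp_diff[OF e evp_shift_back[OF e]]] by auto
  obtain C N where CN: "\<And>n. n \<ge> N \<Longrightarrow> ?g n \<le> C * int ((n + d) choose d)"
    using evp_bound[OF e'] by blast
  have le: "int (num_gens (iset (J ^ n))) \<le> C * int ((n + d) choose d)" if n: "n \<ge> max 1 N" for n
  proof -
    have n1: "Suc (n - 1) = n" using n by simp
    have "ilen (J ^ Suc n) 1 = ilen (J ^ Suc n) (J ^ n) + ilen (J ^ n) 1"
      using flJ by (rule ilen_add) (simp_all add: ideal_times_le2)
    moreover have "ilen (M * J ^ n) (J ^ n) \<le> ilen (J ^ Suc n) (J ^ n)"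
    proof (rule ilen_mono)
      show "flen (J ^ Suc n) (J ^ n)" by (rule flen_sub[OF flJ[of "Suc n"]]) (simp_all add: ideal_times_le2)
      show "J ^ Suc n \<le> M * J ^ n" unfolding power_Suc using JM by (rule ideal_times_mono) simp
    qed (simp_all add: ideal_times_le2)
    ultimately have "int (num_gens (iset (J ^ n))) \<le> ?g n" by (simp only: num_gens_eq n1)
    then show ?thesis using CN[of n] n by linarith
  qed
  show ?thesis by (rule evp_dominated[OF c _ le, where N = "max 1 N"]) simp_all
qed

text \<open>Modulo \<open>J^(p+1) I^j\<close> only products of generators of \<open>J^p\<close> with
  monomials of degree \<open>j + 1\<close> in the \<open>h i\<close> are left, and each spans a
  quotient of \<open>R/(J : I)\<close>.\<close>

lemma length_step:
  fixes h :: "nat \<Rightarrow> 'a"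
  assumes "mprimary J" and I: "I = J + gen (h ` {1..m})"
  shows "ilen (J ^ Suc p * I ^ j) (J ^ p * I ^ Suc j)
    \<le> ilen (icolon J I) 1 * (mcount m (Suc j) * num_gens (iset (J ^ p)))"
proof -
  let ?D = "icolon J I" and ?B = "J ^ Suc p * I ^ j"
  have DI: "?D * I \<le> J" by (simp only: times_le_colon order_refl)
  have "J \<le> ?D" by (simp only: times_le_colon[symmetric] ideal_times_le1)
  then have flD: "flen ?D 1" using flen_mprimary_power[OF assms(1), of 1] by simp
  obtain T where T: "finite T" "card T \<le> mcount m (Suc j)" "gen (h ` {1..m}) ^ Suc j = gen T"
    using power_gens by blast
  have "\<exists>S. finite S \<and> card S = num_gens (iset (J ^ p)) \<and> gen S = J ^ p"
  proof -
    obtain S0 where "finite S0" "J ^ p = gen S0" using fg by blast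
    then have "\<exists>n. \<exists>S. finite S \<and> card S = n \<and> ideal_gen S = iset (J ^ p)"
      using iset_gen by metis
    from LeastI_ex[OF this] show ?thesis
      unfolding num_gens_def iset_gen[symmetric] by (simp only: iset_inject)
  qed
  then obtain S where S: "finite S" "card S = num_gens (iset (J ^ p))" "gen S = J ^ p" by blast
  obtain U where U: "finite U" "card U \<le> card S * card T" "gen S * gen T = gen U"
    using card_gen_times[OF S(1) T(1)] by blast
  have A: "J ^ p * I ^ Suc j = ?B + gen U"
  proof -
    have "I ^ Suc j = J * I ^ j + gen T" unfolding T(3)[symmetric] I by (rule power_sum_ideal)
    then have "J ^ p * I ^ Suc j = J ^ p * (J * I ^ j) + J ^ p * gen T" by (simp only: distrib_left)
    then show ?thesis by (simp add: U(3)[symmetric] S(3) mult_ac)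
  qed
  have "?D * gen U \<le> ?D * (J ^ p * I ^ Suc j)" unfolding A by (intro ideal_times_mono) auto
  \<comment> \<open>One of the \<open>j + 1\<close> factors \<open>I\<close> is set aside for the
    colon ideal, which turns it into \<open>J\<close>.\<close>
  also have "\<dots> = J ^ p * I ^ j * (?D * I)" by (simp add: mult_ac)
  also have "\<dots> \<le> J ^ p * I ^ j * J" using DI by (intro ideal_times_mono) auto
  also have "\<dots> = ?B" by (simp add: mult_ac)
  finally have "?D * gen U \<le> ?B" .
  then have "ilen ?B (J ^ p * I ^ Suc j) \<le> card U * ilen ?D 1"
    unfolding A using flen_gens[OF U(1) flD] by blast
  also have "\<dots> \<le> (num_gens (iset (J ^ p)) * mcount m (Suc j)) * ilen ?D 1"
    using U(2) T(2) S(2) by (intro mult_le_mono1) (metis mult_le_mono2 order_trans)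
  finally show ?thesis by (simp add: mult_ac)
qed

text \<open>Factors \<open>J\<close> are exchanged for \<open>I\<close> one at a time, each exchange
  costing one \<open>length_step\<close>. The bound on \<open>i\<close> leaves enough factors
  \<open>J\<close> to exchange.\<close>

lemma length_filtration:
  fixes h :: "nat \<Rightarrow> 'a"
  assumes "mprimary J" and I: "I = J + gen (h ` {1..m})" and "i \<le> Suc n"
  shows "ilen (J ^ Suc n) (J ^ (Suc n - i) * I ^ i)
    \<le> (\<Sum>j<i. ilen (icolon J I) 1 * (mcount m (Suc j) * num_gens (iset (J ^ (n - j)))))"
  using assms(3)
proof (induction i)
  case (Suc i)
  let ?X = "J ^ (Suc n - i) * I ^ i" and ?Y = "J ^ (n - i) * I ^ Suc i"
  have JI: "J \<le> I" by (simp add: I)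
  have X: "?X = J ^ Suc (n - i) * I ^ i" using Suc.prems by (simp add: Suc_diff_le)
  have "J ^ Suc n = J ^ (Suc n - i) * J ^ i" using Suc.prems by (simp add: power_add[symmetric])
  then have JX: "J ^ Suc n \<le> ?X" using JI by (simp add: ideal_times_mono ideal_power_mono)
  have XY: "?X \<le> ?Y"
    unfolding X power_Suc using ideal_times_mono[OF JI order_refl, of "J ^ (n - i) * I ^ i"]
    by (simp add: mult_ac)
  have "flen (J ^ Suc n) ?Y"
    using flen_sub[OF flen_mprimary_power[OF assms(1) order_refl, of "Suc n"] order_refl] JX XY
    by (meson ideal_le_one order_trans)
  then have "ilen (J ^ Suc n) ?Y = ilen (J ^ Suc n) ?X + ilen ?X ?Y"
    using JX XY by (rule ilen_add)
  also have "ilen ?X ?Y \<le> ilen (icolon J I) 1 * (mcount m (Suc i) * num_gens (iset (J ^ (n - i))))"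
    unfolding X by (rule length_step[OF assms(1,2)])
  finally show ?case using Suc by simp
qed simp

theorem e1_difference_le:
  fixes h :: "nat \<Rightarrow> 'a"
  assumes "mprimary J" "mprimary I" and I: "I = J + gen (h ` {1..m})"
    and "is_reduction J I s" and d: "krull_dim TYPE('a) = Suc d"
  shows "hilbert_coeff (Suc d) (iset I) 1 - hilbert_coeff (Suc d) (iset J) 1
    \<le> int (ilen (icolon J I) 1) * (int ((m + s) choose s) - 1) * fiber_mult (Suc d) (iset J)"
proof -
  obtain cI where cI: "evp (Suc (Suc d)) cI (\<lambda>n. int (ilen (I ^ Suc n) 1))"
    using hilbert_samuel_dim[OF assms(2)] d by auto
  obtain cJ where cJ: "evp (Suc (Suc d)) cJ (\<lambda>n. int (ilen (J ^ Suc n) 1))"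
    using hilbert_samuel_dim[OF assms(1)] d by auto
  obtain f where f: "evp (Suc d) f (\<lambda>n. int (num_gens (iset (J ^ n))))"
    using fiber_polynomial[OF assms(1) d] by blast
  let ?L = "ilen (icolon J I) 1"
  \<comment> \<open>The order \<open>J\<close> minus \<open>I\<close> makes the values nonnegative
    and matches \<open>e_1(I) - e_1(J)\<close>, as \<open>e_1\<close> occurs with a minus
    sign.\<close>
  let ?P = "\<lambda>n. int (ilen (J ^ Suc n) 1) - int (ilen (I ^ Suc n) 1)"
  let ?w = "\<lambda>j. int (?L * mcount m (Suc j))"
  let ?G = "\<lambda>n. \<Sum>j<s. ?w j * int (num_gens (iset (J ^ (n - j))))"
  have "\<forall>j. \<exists>c'. evp (Suc d) c' (\<lambda>n. int (num_gens (iset (J ^ (n - j))))) \<and> c' d = f d"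
    using evp_shift_back_iter[OF f] by blast
  then obtain fs where fs: "\<And>j. evp (Suc d) (fs j) (\<lambda>n. int (num_gens (iset (J ^ (n - j)))))" "\<And>j. fs j d = f d"
    by metis
  have G: "evp (Suc d) (\<lambda>i. \<Sum>j<s. ?w j * fs j i) ?G"
    by (intro evp_sum evp_scale fs)
  have P: "evp (Suc (Suc d)) (\<lambda>i. cJ i - cI i) ?P" using cJ cI by (rule evp_diff)
  have JI: "J ^ Suc n \<le> I ^ Suc n" for n by (rule ideal_power_mono) (simp add: I)
  have PI: "?P n = int (ilen (J ^ Suc n) (I ^ Suc n))" for n
    using ilen_add[OF flen_mprimary_power[OF assms(1) order_refl] JI[of n] ideal_le_one] by simp
  have P0: "0 \<le> ?P n" for n unfolding PI by simp
  have PG: "?P n \<le> ?G n" if "n \<ge> s" for n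
  proof -
    have "I ^ Suc n = J ^ (Suc n - s) * I ^ s"
      using is_reduction_power[OF assms(4), of "Suc n - s"] that by simp
    then have "ilen (J ^ Suc n) (I ^ Suc n)
        \<le> (\<Sum>j<s. ?L * (mcount m (Suc j) * num_gens (iset (J ^ (n - j)))))"
      using length_filtration[OF assms(1) I, of s n] that by simp
    then have "int (ilen (J ^ Suc n) (I ^ Suc n))
        \<le> int (\<Sum>j<s. ?L * (mcount m (Suc j) * num_gens (iset (J ^ (n - j)))))" by (rule of_nat_mono)
    then show ?thesis unfolding PI by (simp add: mult.assoc)
  qed
  text \<open>\<open>?P\<close> lies between \<open>0\<close> and a polynomial of degree \<open>d\<close>, so \<open>e\<^sub>0(I) = e\<^sub>0(J)\<close>.\<close>
  have "0 \<le> cJ (Suc d) - cI (Suc d)" using evp_lead_nonneg[OF P] P0 by blast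
  moreover have "cJ (Suc d) - cI (Suc d) \<le> 0"
    using evp_lead_mono[OF P evp_pad[OF G, of "Suc (Suc d)"] PG] by simp
  ultimately have "evp (Suc d) (\<lambda>i. cJ i - cI i) ?P" by (intro evp_drop[OF P]) simp
  from evp_lead_mono[OF this G PG] have "cJ d - cI d \<le> (\<Sum>j<s. ?w j * f d)" by (simp add: fs)
  also have "\<dots> = int ?L * (\<Sum>j<s. int (mcount m (Suc j))) * f d"
    by (simp add: sum_distrib_left sum_distrib_right)
  \<comment> \<open>Degrees \<open>1\<close> to \<open>s\<close> are counted; the missing monomial
    of degree 0 accounts for the \<open>-1\<close>.\<close>
  also have "(\<Sum>j<s. int (mcount m (Suc j))) = int ((m + s) choose s) - 1"
    unfolding sum_mcount[symmetric] lessThan_Suc_atMost[symmetric]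
    by (simp only: sum.lessThan_Suc_shift) simp
  also have "f d = fiber_mult (Suc d) (iset J)" using fiber_mult_eq[OF f] by simp
  finally show ?thesis
    using hilbert_coeff_eq[OF cI, of 1] hilbert_coeff_eq[OF cJ, of 1] by simp
qed

end

theorem theorem2p6:
  fixes mm J :: "'a::comm_ring_1 set" and h :: "nat \<Rightarrow> 'a" and m d :: nat
  assumes "noetherian_ring TYPE('a)"
    and "local_ring mm"
    and "d = krull_dim TYPE('a)"
    and "d \<ge> 1"
    and "primary_to mm J"
    and "\<forall>i\<in>{1..m}. integral_over_ideal J (h i)"
  shows "let I = ideal_gen (J \<union> h ` {1..m}); s = red_num J I in
    hilbert_coeff d I 1 - hilbert_coeff d J 1
      \<le> int (quot_length (ideal_colon J I)) * (int ((m + s) choose s) - 1) * fiber_mult d J"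
proof -
  define M where "M = Abs_ideal mm"
  interpret noetherian_local M
    using noetherian_localI(1)[OF assms(1,2)] by (simp add: M_def)
  have mm: "iset M = mm" using noetherian_localI(2)[OF assms(1,2)] by (simp add: M_def)
  obtain J' where J': "J = iset J'"
    using assms(5) iset_Abs_ideal unfolding primary_to_def by metis
  define I where "I = J' + gen (h ` {1..m})"
  have I: "ideal_gen (J \<union> h ` {1..m}) = iset I"
    using gen_union[of J "h ` {1..m}"] by (simp add: I_def J' iset_gen[symmetric])
  have mJ: "mprimary J'" using mprimary_primary_to assms(5) by (simp add: mm J')
  have int: "\<forall>i\<in>{1..m}. integral_over_ideal (iset J') (h i)" using assms(6) by (simp add: J')
  have "gen (h ` {1..m}) \<le> M"
    using int integral_in_M mJ by (auto simp: gen_le_iff mprimary_def)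
  then have mI: "mprimary I"
    using mJ by (auto simp: mprimary_def I_def intro: ideal_le_plusI1)
  obtain s where "is_reduction J' I s" using exists_reduction[OF int] by (auto simp: I_def)
  then have red: "is_reduction J' I (red_num J (iset I))" unfolding J' by (rule red_num_is_reduction)
  obtain d' where d': "d = Suc d'" using assms(4) by (cases d) auto
  have "krull_dim TYPE('a) = Suc d'" using assms(3) d' by simp
  note bound = e1_difference_le[OF mJ mI I_def red this]
  have "quot_length (ideal_colon J (iset I)) = ilen (icolon J' I) 1"
    by (simp add: J' quot_length_iset[symmetric])
  then show ?thesis using bound unfolding Let_def I d' by (simp add: J')
qed

end
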